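(* Let $\Sigma$ be a finite monoid, $l\ge1$, and $1\le d_1\le d_2$. Generic $l$-parameter bifurcations in the fundamental network of $\Sigma$ with $d_1$-dimensional internal dynamics are also generic in the same network with $d_2$-dimensional internal dynamics. That is, every $\Sigma$-representation that occurs, up to isomorphism, as the generalized kernel (respectively center subspace) in a generic $l$-parameter bifurcation on $\bigoplus_{\sigma\in\Sigma}\mathbb R^{d_1}$ also occurs, up to isomorphism, as the generalized kernel (respectively center subspace) in a generic $l$-parameter bifurcation on $\bigoplus_{\sigma\in\Sigma}\mathbb R^{d_2}$, with equivalent reduced bifurcation problems.
   Context: Fundamental network: let $\Sigma=\{\sigma_1=\mathrm{Id},\dots,\sigma_n\}$ be a finite monoid and $V$ a finite-dimensional real vector space (internal phase space). $\Sigma$ acts on $\bigoplus_{\sigma\in\Sigma}V$ by $(A_\sigma v)_\tau=v_{\tau\sigma}$. Admissible $l$-parameter families are $\Gamma_f(v,\lambda)$, $\lambda\in\mathbb R^l$, with $(\Gamma_f(v,\lambda))_\sigma=f(v_{\sigma_1\sigma},\dots,v_{\sigma_n\sigma},\lambda)$, $f$ smooth; equivalently (known), the smooth families equivariant under all $A_\sigma$. One assumes $\Gamma_f(0,0)=0$. The generalized kernel (steady state bifurcations) is the generalized eigenspace of $D_v\Gamma_f(0,0)$ for eigenvalue $0$; the center subspace is the sum of the generalized eigenspaces for eigenvalues on the imaginary axis. Both are complementable subrepresentations. Types: an indecomposable representation $U$ is of real, complex or quaternionic type according to whether $\mathrm{End}_\Sigma(U)$ modulo its radical is $\mathbb R$,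 $\mathbb C$ or $\mathbb H$. Write, uniquely up to isomorphism, $\bigoplus_\sigma V\cong\bigoplus_i (W_i^{R})^{s_i^R}\oplus\bigoplus_i (W_i^{C})^{s_i^C}\oplus\bigoplus_i (W_i^{H})^{s_i^H}$ with pairwise non-isomorphic indecomposables $W_i^R,W_i^C,W_i^H$ of real, complex, quaternionic type. Genericity (known classification, used as the meaning of "generic"): let $U\cong\bigoplus_i (W_i^{R})^{\rho_i}\oplus\bigoplus_i (W_i^{C})^{\gamma_i}\oplus\bigoplus_i (W_i^{H})^{\iota_i}$ with $0\le\rho_i\le s_i^R$, $0\le\gamma_i\le s_i^C$, $0\le\iota_i\le s_i^H$. In generic $l$-parameter bifurcations, $U$ occurs as a generalized kernel subject to the condition $K_U=\sum\rho_i+2\sum\gamma_i+4\sum\iota_i\le l$, and as a center subspace subject to the condition $C_U=\sum\lceil\rho_i/2\rceil+\sum\gamma_i+\sum\iota_i\le l$. Reduced problem: equivariant Lyapunov–Schmidt or center manifold reduction yields a generic $\Sigma$-equivariant family $r:U\times\mathbb R^l\to U$ on the generalized kernel or center subspace $U$, with $r(0,0)=0$ and linearization in $U$ at $(0,0)$ having only the eigenvalue $0$ (respectively only eigenvalues on the imaginary axis). Two reduced bifurcation problems are equivalent if posed on equivariantly isomorphic representations, so that conjugation by the isomorphism identifies the two classes of equivariant bifurcation problems. *)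

theory Defs
  imports "HOL-Analysis.Analysis" "HOL-Algebra.QuotRing"
begin

subsection \<open>Real representations of a monoid\<close>

text \<open>A representation is a pair (U, A): a linear subspace U of a Euclidean space and an action
  A of the monoid by linear maps of U. The values of A outside U are irrelevant.\<close>

definition lin_on :: "'u::real_vector set \<Rightarrow> ('u \<Rightarrow> 'w::real_vector) \<Rightarrow> bool" where
  "lin_on U f \<longleftrightarrow> (\<forall>x\<in>U. \<forall>y\<in>U. f (x + y) = f x + f y) \<and> (\<forall>c. \<forall>x\<in>U. f (c *\<^sub>R x) = c *\<^sub>R f x)"

definition is_rep :: "'u::euclidean_space set \<Rightarrow> ('s::monoid_mult \<Rightarrow> 'u \<Rightarrow> 'u) \<Rightarrow> bool" where
  "is_rep U A \<longleftrightarrow> subspace U \<and>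
     (\<forall>\<sigma>. lin_on U (A \<sigma>) \<and> A \<sigma> \<in> U \<rightarrow> U) \<and>
     (\<forall>u\<in>U. A 1 u = u) \<and>
     (\<forall>\<sigma> \<tau>. \<forall>u\<in>U. A (\<sigma> * \<tau>) u = A \<sigma> (A \<tau> u))"

definition equivariant_linear ::
    "'u::euclidean_space set \<Rightarrow> ('s \<Rightarrow> 'u \<Rightarrow> 'u) \<Rightarrow> 'w::euclidean_space set \<Rightarrow> ('s \<Rightarrow> 'w \<Rightarrow> 'w) \<Rightarrow>
     ('u \<Rightarrow> 'w) \<Rightarrow> bool" where
  "equivariant_linear U A W B \<phi> \<longleftrightarrow>
     \<phi> \<in> U \<rightarrow> W \<and> lin_on U \<phi> \<and> (\<forall>\<sigma>. \<forall>u\<in>U. \<phi> (A \<sigma> u) = B \<sigma> (\<phi> u))"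

definition rep_isomorphism ::
    "'u::euclidean_space set \<Rightarrow> ('s \<Rightarrow> 'u \<Rightarrow> 'u) \<Rightarrow> 'w::euclidean_space set \<Rightarrow> ('s \<Rightarrow> 'w \<Rightarrow> 'w) \<Rightarrow>
     ('u \<Rightarrow> 'w) \<Rightarrow> bool" where
  "rep_isomorphism U A W B \<phi> \<longleftrightarrow> equivariant_linear U A W B \<phi> \<and> bij_betw \<phi> U W"

definition rep_iso ::
    "'u::euclidean_space set \<Rightarrow> ('s \<Rightarrow> 'u \<Rightarrow> 'u) \<Rightarrow> 'w::euclidean_space set \<Rightarrow> ('s \<Rightarrow> 'w \<Rightarrow> 'w) \<Rightarrow> bool"
  where "rep_iso U A W B \<longleftrightarrow> (\<exists>\<phi>. rep_isomorphism U A W B \<phi>)"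

definition indecomposable :: "'u::euclidean_space set \<Rightarrow> ('s::monoid_mult \<Rightarrow> 'u \<Rightarrow> 'u) \<Rightarrow> bool" where
  "indecomposable U A \<longleftrightarrow> is_rep U A \<and> U \<noteq> {0} \<and>
     (\<forall>X Y. is_rep X A \<and> is_rep Y A \<and> X \<inter> Y = {0} \<and> {x + y | x y. x \<in> X \<and> y \<in> Y} = U
        \<longrightarrow> X = {0} \<or> Y = {0})"

text \<open>(U, A) is isomorphic to the direct sum, over i < N, of m i copies of (W i, B). The direct sum
  is the space of families x with x (i, k) in W i for i < N and k < m i, and the maps e are the
  restrictions of the isomorphism to the individual summands.\<close>

definition iso_direct_sum ::
    "'u::euclidean_space set \<Rightarrow> ('s \<Rightarrow> 'u \<Rightarrow> 'u) \<Rightarrow> nat \<Rightarrow> (nat \<Rightarrow> 'w::euclidean_space set) \<Rightarrow>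
     ('s \<Rightarrow> 'w \<Rightarrow> 'w) \<Rightarrow> (nat \<Rightarrow> nat) \<Rightarrow> bool" where
  "iso_direct_sum U A N W B m \<longleftrightarrow>
     (\<exists>e :: nat \<times> nat \<Rightarrow> 'w \<Rightarrow> 'u.
        (\<forall>p \<in> Sigma {..<N} (\<lambda>i. {..<m i}). equivariant_linear (W (fst p)) B U A (e p)) \<and>
        bij_betw (\<lambda>x. \<Sum>p\<in>Sigma {..<N} (\<lambda>i. {..<m i}). e p (x p))
          (\<Pi>\<^sub>E p\<in>Sigma {..<N} (\<lambda>i. {..<m i}). W (fst p)) U)"

subsection \<open>Real, complex and quaternionic type\<close>

definition End_ring :: "'u::euclidean_space set \<Rightarrow> ('s \<Rightarrow> 'u \<Rightarrow> 'u) \<Rightarrow> ('u \<Rightarrow> 'u) ring" where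
  "End_ring U A =
     \<lparr>carrier = {\<phi> \<in> extensional U. equivariant_linear U A U A \<phi>},
      mult = compose U,
      one = (\<lambda>u\<in>U. u),
      zero = (\<lambda>u\<in>U. 0),
      add = (\<lambda>\<phi> \<psi>. \<lambda>u\<in>U. \<phi> u + \<psi> u)\<rparr>"

definition left_ideal :: "('a, 'm) ring_scheme \<Rightarrow> 'a set \<Rightarrow> bool" where
  "left_ideal R I \<longleftrightarrow> additive_subgroup I R \<and> (\<forall>r\<in>carrier R. \<forall>x\<in>I. r \<otimes>\<^bsub>R\<^esub> x \<in> I)"

definition maximal_left_ideal :: "('a, 'm) ring_scheme \<Rightarrow> 'a set \<Rightarrow> bool" where
  "maximal_left_ideal R M \<longleftrightarrow> left_ideal R M \<and> M \<noteq> carrier R \<and>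
     (\<forall>I. left_ideal R I \<and> M \<subseteq> I \<longrightarrow> I = M \<or> I = carrier R)"

definition jacobson_radical :: "('a, 'm) ring_scheme \<Rightarrow> 'a set" where
  "jacobson_radical R = {x \<in> carrier R. \<forall>M. maximal_left_ideal R M \<longrightarrow> x \<in> M}"

definition real_numbers_ring :: "real ring" where
  "real_numbers_ring = \<lparr>carrier = UNIV, mult = (*), one = 1, zero = 0, add = (+)\<rparr>"

definition complex_numbers_ring :: "complex ring" where
  "complex_numbers_ring = \<lparr>carrier = UNIV, mult = (*), one = 1, zero = 0, add = (+)\<rparr>"

text \<open>The pair (a, b) stands for the quaternion a + b j.\<close>

definition quaternions_ring :: "(complex \<times> complex) ring" where
  "quaternions_ring =
     \<lparr>carrier = UNIV,
      mult = (\<lambda>(a, b) (c, d). (a * c - b * cnj d, a * d + b * cnj c)),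
      one = (1, 0), zero = (0, 0), add = (+)\<rparr>"

text \<open>The quotient of the endomorphism algebra by its radical is isomorphic to K as a real algebra:
  the second condition says that the ring isomorphism is compatible with the scalars.\<close>

definition End_mod_radical_iso ::
    "'u::euclidean_space set \<Rightarrow> ('s \<Rightarrow> 'u \<Rightarrow> 'u) \<Rightarrow> 'k::real_vector ring \<Rightarrow> bool" where
  "End_mod_radical_iso U A K \<longleftrightarrow>
     (let E = End_ring U A; J = jacobson_radical E in
      \<exists>h \<in> ring_iso (E Quot J) K. \<forall>c::real. h (J +>\<^bsub>E\<^esub> (\<lambda>u\<in>U. c *\<^sub>R u)) = c *\<^sub>R \<one>\<^bsub>K\<^esub>)"

datatype rep_type = Real_Type | Complex_Type | Quaternionic_Type

fun has_type :: "'u::euclidean_space set \<Rightarrow> ('s \<Rightarrow> 'u \<Rightarrow> 'u) \<Rightarrow> rep_type \<Rightarrow> bool" where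
  "has_type U A Real_Type \<longleftrightarrow> End_mod_radical_iso U A real_numbers_ring"
| "has_type U A Complex_Type \<longleftrightarrow> End_mod_radical_iso U A complex_numbers_ring"
| "has_type U A Quaternionic_Type \<longleftrightarrow> End_mod_radical_iso U A quaternions_ring"

subsection \<open>Smooth maps\<close>

text \<open>To be used for linear subspaces S only. There the derivative within S is determined on S
  although not on the whole ambient space, and only its values on S are used.\<close>

fun Ck_on :: "nat \<Rightarrow> 'a::euclidean_space set \<Rightarrow> ('a \<Rightarrow> 'b::euclidean_space) \<Rightarrow> bool" where
  "Ck_on 0 S f \<longleftrightarrow> continuous_on S f"
| "Ck_on (Suc k) S f \<longleftrightarrow> f differentiable_on S \<and>
     (\<forall>v\<in>S. Ck_on k S (\<lambda>x. frechet_derivative f (at x within S) v))"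

definition smooth_on_subspace :: "'a::euclidean_space set \<Rightarrow> ('a \<Rightarrow> 'b::euclidean_space) \<Rightarrow> bool" where
  "smooth_on_subspace S f \<longleftrightarrow> (\<forall>k. Ck_on k S f)"

subsection \<open>Complex eigenvalues of real linear maps\<close>

text \<open>The complexification of a real vector space consists of the pairs (x, y), read as x + i y.\<close>

definition cscale :: "complex \<Rightarrow> 'u::real_vector \<times> 'u \<Rightarrow> 'u \<times> 'u" where
  "cscale \<mu> z = (Re \<mu> *\<^sub>R fst z - Im \<mu> *\<^sub>R snd z, Im \<mu> *\<^sub>R fst z + Re \<mu> *\<^sub>R snd z)"

definition complexify :: "('u \<Rightarrow> 'u) \<Rightarrow> 'u \<times> 'u \<Rightarrow> 'u \<times> 'u" where
  "complexify L z = (L (fst z), L (snd z))"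

definition eigenvalue_on :: "'u::real_vector set \<Rightarrow> ('u \<Rightarrow> 'u) \<Rightarrow> complex \<Rightarrow> bool" where
  "eigenvalue_on U L \<mu> \<longleftrightarrow> (\<exists>z \<in> U \<times> U. z \<noteq> 0 \<and> complexify L z = cscale \<mu> z)"

definition gen_eigenspace :: "('u::real_vector \<Rightarrow> 'u) \<Rightarrow> complex \<Rightarrow> ('u \<times> 'u) set" where
  "gen_eigenspace L \<mu> = {z. \<exists>k. ((\<lambda>w. complexify L w - cscale \<mu> w) ^^ k) z = 0}"

definition generalized_kernel :: "('u::real_vector \<Rightarrow> 'u) \<Rightarrow> 'u set" where
  "generalized_kernel L = {x. \<exists>k. (L ^^ k) x = 0}"

text \<open>The real points of the sum of the generalized eigenspaces for the eigenvalues on the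
  imaginary axis. Each of these is a complex subspace, so that the real span is their sum.\<close>

definition center_subspace :: "('u::real_vector \<Rightarrow> 'u) \<Rightarrow> 'u set" where
  "center_subspace L = {x. (x, 0) \<in> span (\<Union>\<mu>\<in>{\<mu>. Re \<mu> = 0}. gen_eigenspace L \<mu>)}"

subsection \<open>Fundamental networks\<close>

text \<open>The monoid is the type 's, and the total phase space is the type \<open>('v, 's) vec\<close>, the direct sum
  over 's of copies of the internal phase space 'v.\<close>

definition net_action :: "'s::{finite,monoid_mult} \<Rightarrow> ('v::euclidean_space, 's) vec \<Rightarrow> ('v, 's) vec" where
  "net_action \<sigma> v = (\<chi> \<tau>. v $ (\<tau> * \<sigma>))"

text \<open>The arguments of the response function f are indexed by the monoid elements, the argument
  belonging to \<open>\<tau>\<close> being \<open>v $ (\<tau> * \<sigma>)\<close>.\<close>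

definition net_field ::
    "(('v::euclidean_space, 's::{finite,monoid_mult}) vec \<times> (real^'l) \<Rightarrow> 'v) \<Rightarrow> ('v, 's) vec \<Rightarrow> real^'l \<Rightarrow> ('v, 's) vec"
  where "net_field f v p = (\<chi> \<sigma>. f (\<chi> \<tau>. v $ (\<tau> * \<sigma>), p))"

definition net_bifurcation ::
    "(('v::euclidean_space, 's::{finite,monoid_mult}) vec \<times> (real^'l) \<Rightarrow> 'v) \<Rightarrow> bool" where
  "net_bifurcation f \<longleftrightarrow> smooth_on_subspace UNIV f \<and> net_field f 0 0 = 0"

definition net_linearization ::
    "(('v::euclidean_space, 's::{finite,monoid_mult}) vec \<times> (real^'l) \<Rightarrow> 'v) \<Rightarrow> ('v, 's) vec \<Rightarrow> ('v, 's) vec" where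
  "net_linearization f = frechet_derivative (\<lambda>v. net_field f v 0) (at 0)"

subsection \<open>Generic bifurcations\<close>

fun kernel_cost :: "rep_type \<Rightarrow> nat \<Rightarrow> nat" where
  "kernel_cost Real_Type m = m"
| "kernel_cost Complex_Type m = 2 * m"
| "kernel_cost Quaternionic_Type m = 4 * m"

fun center_cost :: "rep_type \<Rightarrow> nat \<Rightarrow> nat" where
  "center_cost Real_Type m = nat \<lceil>real m / 2\<rceil>"
| "center_cost Complex_Type m = m"
| "center_cost Quaternionic_Type m = m"

text \<open>The known classification: with s i the multiplicity in \<open>('v, 's) vec\<close> and m i the multiplicity
  in U of the indecomposable W i of type t i, the representation U occurs generically with l
  parameters if m i is at most s i and the total cost is at most l. The W i are summands of \<open>('v, 's) vec\<close>
  up to isomorphism and are therefore taken to be subspaces of it. By the Krull-Schmidt theorem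
  the choice of the decomposition is immaterial.\<close>

definition generic_rep ::
    "'v::euclidean_space itself \<Rightarrow> (rep_type \<Rightarrow> nat \<Rightarrow> nat) \<Rightarrow> nat \<Rightarrow>
     'u::euclidean_space set \<Rightarrow> ('s::{finite,monoid_mult} \<Rightarrow> 'u \<Rightarrow> 'u) \<Rightarrow> bool" where
  "generic_rep V cost l U A \<longleftrightarrow>
     (\<exists>N (W :: nat \<Rightarrow> ('v, 's) vec set) t s m.
        (\<forall>i<N. indecomposable (W i) net_action \<and> has_type (W i) net_action (t i)) \<and>
        (\<forall>i<N. \<forall>j<N. i \<noteq> j \<longrightarrow> \<not> rep_iso (W i) net_action (W j) net_action) \<and>
        iso_direct_sum (UNIV :: ('v, 's) vec set) net_action N W net_action s \<and>
        iso_direct_sum U A N W net_action m \<and>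
        (\<forall>i<N. m i \<le> s i) \<and>
        (\<Sum>i<N. cost (t i) (m i)) \<le> l)"

text \<open>f is an admissible family realizing U, and U satisfies the genericity condition; the latter
  is a condition on U and not on the dependence of f on the parameters.\<close>

definition occurs_as_generic_kernel ::
    "'u::euclidean_space set \<Rightarrow> ('s::{finite,monoid_mult} \<Rightarrow> 'u \<Rightarrow> 'u) \<Rightarrow>
     (('v::euclidean_space, 's) vec \<times> (real^'l) \<Rightarrow> 'v) \<Rightarrow> bool" where
  "occurs_as_generic_kernel U A f \<longleftrightarrow> net_bifurcation f \<and>
     rep_iso U A (generalized_kernel (net_linearization f)) net_action \<and>
     generic_rep TYPE('v) kernel_cost CARD('l) U A"

definition occurs_as_generic_center ::
    "'u::euclidean_space set \<Rightarrow> ('s::{finite,monoid_mult} \<Rightarrow> 'u \<Rightarrow> 'u) \<Rightarrow>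
     (('v::euclidean_space, 's) vec \<times> (real^'l) \<Rightarrow> 'v) \<Rightarrow> bool" where
  "occurs_as_generic_center U A f \<longleftrightarrow> net_bifurcation f \<and>
     rep_iso U A (center_subspace (net_linearization f)) net_action \<and>
     generic_rep TYPE('v) center_cost CARD('l) U A"

subsection \<open>Reduced bifurcation problems\<close>

text \<open>The smooth equivariant families on U whose linearization at the origin has only eigenvalues
  in the set Z.\<close>

definition reduced_problems ::
    "complex set \<Rightarrow> 'u::euclidean_space set \<Rightarrow> ('s \<Rightarrow> 'u \<Rightarrow> 'u) \<Rightarrow> ('u \<times> (real^'l) \<Rightarrow> 'u) set" where
  "reduced_problems Z U A =
     {r \<in> U \<times> UNIV \<rightarrow>\<^sub>E U.
        smooth_on_subspace (U \<times> UNIV) r \<and>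
        (\<forall>\<sigma>. \<forall>u\<in>U. \<forall>p. r (A \<sigma> u, p) = A \<sigma> (r (u, p))) \<and>
        r (0, 0) = 0 \<and>
        (\<forall>\<mu>. eigenvalue_on U (frechet_derivative (\<lambda>u. r (u, 0)) (at 0 within U)) \<mu> \<longrightarrow> \<mu> \<in> Z)}"

definition conjugate_family ::
    "'u::euclidean_space set \<Rightarrow> 'w::euclidean_space set \<Rightarrow> ('u \<Rightarrow> 'w) \<Rightarrow>
     ('u \<times> (real^'l) \<Rightarrow> 'u) \<Rightarrow> ('w \<times> (real^'l) \<Rightarrow> 'w)" where
  "conjugate_family U W \<phi> r =
     restrict (\<lambda>(w, p). \<phi> (r (inv_into U \<phi> w, p))) (W \<times> UNIV)"

definition equivalent_reduced_problems ::
    "(real^'l) itself \<Rightarrow> complex set \<Rightarrow> 'u::euclidean_space set \<Rightarrow> ('s \<Rightarrow> 'u \<Rightarrow> 'u) \<Rightarrow>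
     'w::euclidean_space set \<Rightarrow> ('s \<Rightarrow> 'w \<Rightarrow> 'w) \<Rightarrow> bool" where
  "equivalent_reduced_problems P Z U A W B \<longleftrightarrow>
     (\<exists>\<phi>. rep_isomorphism U A W B \<phi> \<and>
        bij_betw (conjugate_family U W \<phi>)
          (reduced_problems Z U A :: ('u \<times> (real^'l) \<Rightarrow> 'u) set)
          (reduced_problems Z W B))"

end

theory Submission
  imports Defs
begin

text \<open>A linear embedding j of the smaller internal phase space V1 into the larger one V2, with a linear
  left inverse q, turns a response function f into the function that is j f q on the range of j and
  the identity on the kernel of q. The linearization then has only the additional eigenvalue 1, so
  that j maps the generalized kernel and the center subspace isomorphically onto the new ones.
  The genericity condition is preserved because the multiplicities in the larger network only grow:
  its total phase space is the image of the smaller one plus the kernel of q, and every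
  indecomposable summand Y of that kernel is one of the old summands. Indeed the identity of Y is a
  sum of maps that factor through the old summands, and by Fitting's lemma one of these maps is
  invertible.\<close>

subsection \<open>Linear and equivariant maps\<close>

text \<open>The eigenvalue 1 serves both halves at once, since it is neither 0 nor on the imaginary
  axis. The work lies in the genericity condition, which compares the multiplicities in
  \<open>U\<close> with those in the full phase space. Relating both phase spaces to copies of the
  one with one-dimensional internal dynamics would determine the multiplicities only through the
  uniqueness part of the Krull-Schmidt theorem. The splitting lets the given decomposition be
  continued instead: the multiplicities in \<open>U\<close>, and with them the cost, stay fixed.
  What must be excluded is an indecomposable summand of a new isomorphism type. None exists because
  each coordinate of the larger internal space can be routed through a single line of the smaller
  one, and maps that act in every cell separately and in the same way are equivariant. Since the
  summands in \<open>generic_rep\<close> are subspaces of the phase space in question,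
  indecomposability and type must also be carried over to the images of the old summands; hence the
  transport of Jacobson radicals.\<close>

lemma lin_on_zero:
  assumes "lin_on U f" "subspace U"
  shows "f 0 = 0"
proof -
  have "f (0 *\<^sub>R 0) = 0 *\<^sub>R f 0"
    using assms unfolding lin_on_def by (meson subspace_0)
  then show ?thesis by simp
qed

lemma lin_on_diff:
  assumes "lin_on U f" "subspace U" "x \<in> U" "y \<in> U"
  shows "f (x - y) = f x - f y"
proof -
  have "f (x + (-1) *\<^sub>R y) = f x + (-1) *\<^sub>R f y"
    using assms unfolding lin_on_def by (metis subspace_mul)
  then show ?thesis by simp
qed

lemma lin_on_sum:
  assumes "lin_on U f" "subspace U" "finite I" "\<And>i. i \<in> I \<Longrightarrow> x i \<in> U"
  shows "f (\<Sum>i\<in>I. x i) = (\<Sum>i\<in>I. f (x i))"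
  using assms(3,4)
proof (induction I rule: finite_induct)
  case empty
  then show ?case using lin_on_zero[OF assms(1,2)] by simp
next
  case (insert a I)
  then have "(\<Sum>i\<in>I. x i) \<in> U" using assms(2) by (auto intro: subspace_sum)
  then show ?case using insert assms(1) by (simp add: lin_on_def)
qed

text \<open>Equivariant maps are linear only on their carriers, while the rules for derivatives are
  applied to globally linear maps. Extending from a basis of \<open>U\<close> bridges the two when
  smooth families are conjugated.\<close>

lemma lin_on_extend:
  fixes f :: "'u::euclidean_space \<Rightarrow> 'w::real_vector"
  assumes "lin_on U f" "subspace U"
  obtains g where "linear g" "\<And>u. u \<in> U \<Longrightarrow> g u = f u"
proof -
  obtain B where B: "B \<subseteq> U" "independent B" "U \<subseteq> span B"
    by (meson basis_exists)
  obtain g where g: "linear g" "\<forall>x\<in>B. g x = f x"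
    using linear_independent_extend[OF B(2), of f] by blast
  have "subspace {x \<in> U. g x = f x}"
    using assms g(1) lin_on_zero[OF assms]
    by (auto simp: subspace_def lin_on_def linear_0 linear_add linear_scale)
  then have "span B \<subseteq> {x \<in> U. g x = f x}"
    using B(1) g(2) by (intro span_minimal) auto
  then show ?thesis using that[of g] g(1) B(3) by auto
qed

lemma equivariant_linearI:
  assumes "\<And>u. u \<in> U \<Longrightarrow> f u \<in> W"
    and "\<And>x y. x \<in> U \<Longrightarrow> y \<in> U \<Longrightarrow> f (x + y) = f x + f y"
    and "\<And>c x. x \<in> U \<Longrightarrow> f (c *\<^sub>R x) = c *\<^sub>R f x"
    and "\<And>\<sigma> u. u \<in> U \<Longrightarrow> f (A \<sigma> u) = B \<sigma> (f u)"
  shows "equivariant_linear U A W B f"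
  using assms by (auto simp: equivariant_linear_def lin_on_def)

lemma equivariant_linearD:
  assumes "equivariant_linear U A W B f"
  shows "u \<in> U \<Longrightarrow> f u \<in> W"
    and "x \<in> U \<Longrightarrow> y \<in> U \<Longrightarrow> f (x + y) = f x + f y"
    and "x \<in> U \<Longrightarrow> f (c *\<^sub>R x) = c *\<^sub>R f x"
    and "u \<in> U \<Longrightarrow> f (A \<sigma> u) = B \<sigma> (f u)"
    and "lin_on U f"
  using assms by (auto simp: equivariant_linear_def lin_on_def)

lemma equivariant_linear_compose:
  assumes "equivariant_linear U A V B f" "equivariant_linear V B W C g"
  shows "equivariant_linear U A W C (\<lambda>x. g (f x))"
  using equivariant_linearD[OF assms(1)] equivariant_linearD[OF assms(2)]
  by (intro equivariant_linearI) simp_all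

lemma equivariant_linear_mono:
  assumes "equivariant_linear U A W B f" "U' \<subseteq> U" "W \<subseteq> W'"
  shows "equivariant_linear U' A W' B f"
  using equivariant_linearD[OF assms(1)] assms(2,3)
  by (intro equivariant_linearI) (simp_all add: subset_iff)

lemma equivariant_linear_ident: "equivariant_linear U A U A (\<lambda>x. x)"
  by (rule equivariant_linearI) auto

text \<open>By \<open>is_rep U A\<close> the sums, the multiples and \<open>A \<sigma> u\<close>
  stay inside \<open>U\<close>, where \<open>g\<close> equals \<open>f\<close>. This allows
  endomorphisms to be replaced by their restrictions, the form that \<open>End_ring\<close>
  requires.\<close>

lemma equivariant_linear_cong:
  assumes "equivariant_linear U A W B f" "is_rep U A" "\<And>u. u \<in> U \<Longrightarrow> g u = f u"
  shows "equivariant_linear U A W B g"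
  using equivariant_linearD[OF assms(1)] assms(2,3)
  by (intro equivariant_linearI) (auto simp: is_rep_def subspace_def Pi_iff)

lemma is_repD:
  assumes "is_rep U A"
  shows "subspace U" "u \<in> U \<Longrightarrow> A \<sigma> u \<in> U" "lin_on U (A \<sigma>)"
    "u \<in> U \<Longrightarrow> A 1 u = u" "u \<in> U \<Longrightarrow> A (\<sigma> * \<tau>) u = A \<sigma> (A \<tau> u)"
  using assms by (auto simp: is_rep_def)

lemma is_rep_subrep:
  assumes "is_rep U A" "subspace X" "X \<subseteq> U" "\<And>\<sigma> x. x \<in> X \<Longrightarrow> A \<sigma> x \<in> X"
  shows "is_rep X A"
  using assms unfolding is_rep_def lin_on_def by (auto simp: subset_iff)

lemma equivariant_linear_add:
  assumes "equivariant_linear U A W B f" "equivariant_linear U A W B g" "is_rep W B"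
  shows "equivariant_linear U A W B (\<lambda>x. f x + g x)"
  using equivariant_linearD[OF assms(1)] equivariant_linearD[OF assms(2)]
    is_repD(1,3)[OF assms(3)]
  by (intro equivariant_linearI) (auto simp: scaleR_add_right subspace_add lin_on_def)

lemma equivariant_linear_zero:
  assumes "is_rep W B"
  shows "equivariant_linear U A W B (\<lambda>x. 0)"
  using is_repD(1)[OF assms] lin_on_zero[OF is_repD(3)[OF assms] is_repD(1)[OF assms]]
  by (intro equivariant_linearI) (auto simp: subspace_0)

lemma equivariant_linear_sum:
  assumes "finite I" "\<And>i. i \<in> I \<Longrightarrow> equivariant_linear U A W B (f i)" "is_rep W B"
  shows "equivariant_linear U A W B (\<lambda>x. \<Sum>i\<in>I. f i x)"
  using assms(1,2)
proof (induction I rule: finite_induct)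
  case empty
  then show ?case using equivariant_linear_zero[OF assms(3)] by simp
next
  case (insert a I)
  then show ?case by (simp add: equivariant_linear_add[OF _ _ assms(3)])
qed

lemma equivariant_linear_funpow:
  assumes "equivariant_linear U A U A f"
  shows "equivariant_linear U A U A (f ^^ n)"
proof (induction n)
  case 0
  then show ?case using equivariant_linear_ident by (simp add: id_def)
next
  case (Suc n)
  then show ?case using equivariant_linear_compose[OF _ assms] by (simp add: comp_def)
qed

section \<open>Images, kernels and isomorphisms of representations\<close>

lemma subspace_equivariant_image:
  assumes "is_rep U A" "equivariant_linear U A W B f"
  shows "subspace (f ` U)"
proof -
  note U = is_repD(1)[OF assms(1)] and f = equivariant_linearD[OF assms(2)]
  show ?thesis
    unfolding subspace_def
  proof (intro conjI ballI allI)
    show "0 \<in> f ` U" using lin_on_zero[OF f(5) U] subspace_0[OF U] by force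
    show "x + y \<in> f ` U" if "x \<in> f ` U" "y \<in> f ` U" for x y
      using that f(2) subspace_add[OF U] by (metis (no_types, lifting) imageE imageI)
    show "c *\<^sub>R x \<in> f ` U" if "x \<in> f ` U" for c x
      using that f(3) subspace_scale[OF U] by (metis (no_types, lifting) imageE imageI)
  qed
qed

lemma is_rep_image:
  assumes "is_rep U A" "equivariant_linear U A W B f" "is_rep W B"
  shows "is_rep (f ` U) B"
proof (rule is_rep_subrep[OF assms(3) subspace_equivariant_image[OF assms(1,2)]])
  note f = equivariant_linearD[OF assms(2)]
  show "f ` U \<subseteq> W" using f(1) by auto
  show "B \<sigma> x \<in> f ` U" if "x \<in> f ` U" for \<sigma> x
    using that f(4) is_repD(2)[OF assms(1)] by (metis (no_types, lifting) imageE imageI)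
qed

lemma is_rep_kernel:
  assumes "is_rep U A" "equivariant_linear U A W B f" "is_rep W B"
  shows "is_rep {u \<in> U. f u = 0} A"
proof (rule is_rep_subrep[OF assms(1)])
  note f = equivariant_linearD[OF assms(2)] and U = is_repD[OF assms(1)] and W = is_repD[OF assms(3)]
  have 0: "f 0 = 0" using f(5) U(1) by (rule lin_on_zero)
  have B0: "B \<sigma> 0 = 0" for \<sigma> using W(3) W(1) by (rule lin_on_zero)
  show "subspace {u \<in> U. f u = 0}"
    using 0 U(1) f(2,3) by (auto simp: subspace_def)
  show "A \<sigma> x \<in> {u \<in> U. f u = 0}" if "x \<in> {u \<in> U. f u = 0}" for \<sigma> x
    using that U(2) f(4) B0 by auto
qed auto

lemma rep_isomorphismI:
  assumes "equivariant_linear U A W B f" "equivariant_linear W B U A g"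
    and "\<And>u. u \<in> U \<Longrightarrow> g (f u) = u" "\<And>w. w \<in> W \<Longrightarrow> f (g w) = w"
  shows "rep_isomorphism U A W B f"
  using assms equivariant_linearD(1)[OF assms(1)] equivariant_linearD(1)[OF assms(2)]
  by (auto simp: rep_isomorphism_def intro!: bij_betwI[where g = g])

lemma rep_isomorphism_inverse:
  assumes "rep_isomorphism U A W B f" "subspace U" "\<And>\<sigma> u. u \<in> U \<Longrightarrow> A \<sigma> u \<in> U"
  shows "\<exists>g. equivariant_linear W B U A g \<and> (\<forall>u\<in>U. g (f u) = u) \<and> (\<forall>w\<in>W. f (g w) = w)"
proof (intro exI conjI ballI)
  have e: "equivariant_linear U A W B f" and b: "bij_betw f U W"
    using assms(1) by (auto simp: rep_isomorphism_def)
  note f = equivariant_linearD[OF e]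
  let ?g = "inv_into U f"
  show gf: "?g (f u) = u" if "u \<in> U" for u using b that by (simp add: bij_betw_inv_into_left)
  show fg: "f (?g w) = w" if "w \<in> W" for w using b that by (simp add: bij_betw_inv_into_right)
  have gU: "?g w \<in> U" if "w \<in> W" for w using b that by (metis bij_betw_def inv_into_into)
  show "equivariant_linear W B U A ?g"
  proof (rule equivariant_linearI)
    show "?g (x + y) = ?g x + ?g y" if "x \<in> W" "y \<in> W" for x y
      by (metis f(2) fg gU gf subspace_add[OF assms(2)] that)
    show "?g (c *\<^sub>R x) = c *\<^sub>R ?g x" if "x \<in> W" for c x
      by (metis f(3) fg gU gf subspace_scale[OF assms(2)] that)
    show "?g (B \<sigma> w) = A \<sigma> (?g w)" if "w \<in> W" for \<sigma> w
      by (metis f(4) fg gU gf assms(3) that)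
  qed (rule gU)
qed

lemma rep_isoE:
  assumes "rep_iso U A W B" "is_rep U A"
  obtains f g where "rep_isomorphism U A W B f"
    "equivariant_linear U A W B f" "equivariant_linear W B U A g"
    "\<forall>u\<in>U. g (f u) = u" "\<forall>w\<in>W. f (g w) = w"
proof -
  obtain f where f: "rep_isomorphism U A W B f" using assms(1) by (auto simp: rep_iso_def)
  then show ?thesis
    using rep_isomorphism_inverse[OF f is_repD(1,2)[OF assms(2)]] that
    by (auto simp: rep_isomorphism_def)
qed

lemma rep_iso_sym:
  assumes "rep_iso U A W B" "is_rep U A"
  shows "rep_iso W B U A"
proof -
  obtain f g where "equivariant_linear U A W B f" "equivariant_linear W B U A g"
    "\<forall>u\<in>U. g (f u) = u" "\<forall>w\<in>W. f (g w) = w"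
    using rep_isoE[OF assms] by metis
  then have "rep_isomorphism W B U A g" by (auto intro: rep_isomorphismI)
  then show ?thesis by (auto simp: rep_iso_def)
qed

lemma rep_iso_trans:
  assumes "rep_iso U A V B" "rep_iso V B W C"
  shows "rep_iso U A W C"
proof -
  obtain f g where "rep_isomorphism U A V B f" "rep_isomorphism V B W C g"
    using assms by (auto simp: rep_iso_def)
  then have "rep_isomorphism U A W C (\<lambda>x. g (f x))"
    using bij_betw_trans[of f U V g W]
    by (auto simp: rep_isomorphism_def comp_def intro: equivariant_linear_compose)
  then show ?thesis by (auto simp: rep_iso_def)
qed

text \<open>Every point of \<open>W\<close> has the form \<open>f u\<close>, and there each axiom
  for \<open>B\<close> is the image under \<open>f\<close> of the axiom for \<open>A\<close> at
  \<open>u\<close>.\<close>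

lemma is_rep_isomorphic:
  assumes "rep_isomorphism U A W B f" "is_rep U A"
  shows "is_rep W B"
proof -
  have e: "equivariant_linear U A W B f" and W: "W = f ` U"
    using assms(1) by (auto simp: rep_isomorphism_def bij_betw_def)
  note f = equivariant_linearD[OF e] and U = is_repD[OF assms(2)]
  have "lin_on W (B \<sigma>)" for \<sigma>
    unfolding lin_on_def W using f(2,3,4) U(1-3)
    by (auto simp: lin_on_def subspace_add subspace_scale
        simp flip: f(2,3,4))
  then show ?thesis
    unfolding is_rep_def
    using subspace_equivariant_image[OF assms(2) e] f(4) U(2,4,5)
    by (auto simp: W simp flip: f(4))
qed

subsection \<open>Fitting's lemma\<close>

text \<open>At an exponent where the ranges and the kernels of the powers of the map
  are stationary, they are complementary subrepresentations.\<close>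

lemma indecomposable_endomorphism_cases:
  fixes U :: "'u::euclidean_space set" and A :: "'s::monoid_mult \<Rightarrow> 'u \<Rightarrow> 'u"
  assumes "indecomposable U A" "equivariant_linear U A U A f"
  obtains "bij_betw f U U" | n where "\<And>u. u \<in> U \<Longrightarrow> (f ^^ n) u = 0"
proof -
  have U: "is_rep U A" using assms(1) by (simp add: indecomposable_def)
  note f = equivariant_linearD[OF assms(2)] and UD = is_repD[OF U]
  note fn = equivariant_linear_funpow[OF assms(2)]
  note fnD = equivariant_linearD[OF fn]
  define I where "I n = (f ^^ n) ` U" for n
  define K where "K n = {u \<in> U. (f ^^ n) u = 0}" for n
  have I: "is_rep (I n) A" and K: "is_rep (K n) A" for n
    unfolding I_def K_def using is_rep_image[OF U fn U] is_rep_kernel[OF U fn U] by auto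
  have I_mono: "I (m + n) \<subseteq> I m" for m n
    unfolding I_def using fnD(1)[of _ n] by (auto simp: funpow_add)
  have K_mono: "K n \<subseteq> K (m + n)" for m n
    unfolding K_def using lin_on_zero[OF fnD(5) UD(1)] by (auto simp: funpow_add)
  \<comment> \<open>Images shrink and kernels grow with the exponent, so both are stationary from
    the exponents on at which the dimension of the image is least and that of the kernel is
    greatest.\<close>
  obtain a where a: "\<And>n. dim (I a) \<le> dim (I n)"
    using ex_has_least_nat[of "\<lambda>_. True" 0 "\<lambda>n. dim (I n)"] by auto
  obtain b where b: "\<And>n. dim (K n) \<le> dim (K b)"
    using ex_has_greatest_nat[of "\<lambda>_. True" 0 "\<lambda>n. dim (K n)" "Suc DIM('u)"]
      dim_subset_UNIV[where 'a='u] by (metis less_Suc_eq_le)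
  have Ia: "I (a + n) = I a" for n
    using subspace_dim_equal[OF is_repD(1)[OF I] is_repD(1)[OF I] I_mono a] .
  have Kb: "K (n + b) = K b" for n
    using subspace_dim_equal[OF is_repD(1)[OF K] is_repD(1)[OF K] K_mono b, of n] by simp
  \<comment> \<open>Beyond both \<open>a\<close> and \<open>b\<close>, doubling the exponent changes
    neither the image nor the kernel. The successor makes \<open>n\<close> positive, so that
    \<open>I n\<close> lies in the range of \<open>f\<close> and \<open>f x = 0\<close> implies
    \<open>(f ^^ n) x = 0\<close>.\<close>
  define n where "n = Suc (a + b)"
  have In: "I (n + n) = I n" using Ia[of "Suc b"] Ia[of "Suc b + n"] by (simp add: n_def add_ac)
  have Kn: "K (n + n) = K n" using Kb[of "Suc a"] Kb[of "Suc a + n"] by (simp add: n_def add_ac)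
  have cap: "I n \<inter> K n = {0}"
  proof -
    have "x = 0" if "x \<in> I n" "x \<in> K n" for x
    proof -
      obtain u where u: "u \<in> U" "x = (f ^^ n) u" using \<open>x \<in> I n\<close> by (auto simp: I_def)
      then have "u \<in> K (n + n)" using \<open>x \<in> K n\<close> by (auto simp: K_def funpow_add)
      then show ?thesis using u Kn by (auto simp: K_def)
    qed
    then show ?thesis using subspace_0[OF is_repD(1)[OF I]] subspace_0[OF is_repD(1)[OF K]] by auto
  qed
  have sum: "{x + y |x y. x \<in> I n \<and> y \<in> K n} = U"
  proof (intro equalityI subsetI)
    fix u assume u: "u \<in> U"
    then have "(f ^^ n) u \<in> I (n + n)" using In by (auto simp: I_def)
    \<comment> \<open>The stationary image solves \<open>(f ^^ n) u = (f ^^ n) ((f ^^ n) z)\<close>,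
      so \<open>u\<close> differs from a point of the image by a point of the kernel.\<close>
    then obtain z where z: "z \<in> U" "(f ^^ n) u = (f ^^ n) ((f ^^ n) z)"
      by (auto simp: I_def funpow_add)
    have "u - (f ^^ n) z \<in> K n"
      unfolding K_def using u z lin_on_diff[OF fnD(5) UD(1), of u "(f ^^ n) z"]
      by (auto simp: fnD(1) subspace_diff[OF UD(1)])
    moreover have "(f ^^ n) z \<in> I n" using z by (auto simp: I_def)
    moreover have "u = (f ^^ n) z + (u - (f ^^ n) z)" by simp
    ultimately show "u \<in> {x + y |x y. x \<in> I n \<and> y \<in> K n}" by blast
  qed (use fnD(1) subspace_add[OF UD(1)] in \<open>auto simp: I_def K_def\<close>)
  consider "I n = {0}" | "K n = {0}"
    using assms(1) I K cap sum unfolding indecomposable_def by blast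
  then show ?thesis
  proof cases
    case 1
    then have "(f ^^ n) u = 0" if "u \<in> U" for u using that by (auto simp: I_def)
    then show ?thesis using that(2) by blast
  next
    case 2
    have "I n = U"
      using sum 2 by auto
    moreover have "I n \<subseteq> f ` U" using fnD(1) by (auto simp: I_def n_def)
    ultimately have sur: "f ` U = U" using f(1) by auto
    have "x = y" if "x \<in> U" "y \<in> U" "f x = f y" for x y
    proof -
      have "f (x - y) = 0" using lin_on_diff[OF f(5) UD(1)] that by simp
      then have "(f ^^ n) (x - y) = 0"
        using lin_on_zero[OF fnD(5) UD(1)] by (simp add: n_def funpow_swap1)
      then have "x - y \<in> K n" using that subspace_diff[OF UD(1)] by (auto simp: K_def)
      then show ?thesis using 2 by simp
    qed
    then have "bij_betw f U U" using sur by (auto simp: bij_betw_def inj_on_def)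
    then show ?thesis using that(1) by blast
  qed
qed

section \<open>Locality of the endomorphism ring of an indecomposable representation\<close>

lemma indecomposable_endomorphism_injective:
  assumes "indecomposable U A" "equivariant_linear U A U A f"
    and inj: "\<And>u. u \<in> U \<Longrightarrow> f u = 0 \<Longrightarrow> u = 0"
  shows "bij_betw f U U"
  using assms(1,2)
proof (cases rule: indecomposable_endomorphism_cases)
  case (2 n)
  have "is_rep U A" "U \<noteq> {0}" using assms(1) by (auto simp: indecomposable_def)
  \<comment> \<open>All powers of an injective map are injective, so nilpotency would force
    \<open>U = {0}\<close>.\<close>
  moreover have "u = 0" if "u \<in> U" "(f ^^ k) u = 0" for u k
    using that(2)
  proof (induction k)
    case (Suc k)
    then show ?case
      using inj equivariant_linearD(1)[OF equivariant_linear_funpow[OF assms(2)] that(1)] by simp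
  qed simp
  ultimately show ?thesis using 2 is_repD(1) subspace_0 by blast
qed

text \<open>A composite that is injective has an injective first factor, and on an indecomposable
  representation injectivity is enough.\<close>

lemma indecomposable_left_factor_bijective:
  assumes "indecomposable U A" "equivariant_linear U A U A q" "bij_betw (\<lambda>u. k (q u)) U U"
  shows "bij_betw q U U"
proof (rule indecomposable_endomorphism_injective[OF assms(1,2)])
  have "is_rep U A" using assms(1) by (simp add: indecomposable_def)
  note U = is_repD(1)[OF this]
  have "q 0 = 0" by (rule lin_on_zero[OF equivariant_linearD(5)[OF assms(2)] U])
  then show "u = 0" if "u \<in> U" "q u = 0" for u
    using that inj_onD[OF bij_betw_imp_inj_on[OF assms(3)], of u 0] subspace_0[OF U] by simp
qed

text \<open>Non-units are closed under addition. After composition with the inverse \<open>k\<close>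
  of the sum, the maps \<open>k f\<close> and \<open>k g\<close> add up to the identity. If
  \<open>k f\<close> is not invertible it is nilpotent, and then \<open>k g\<close> is injective,
  because \<open>k f\<close> fixes every element of its kernel and a nilpotent map fixes only
  0.\<close>

lemma indecomposable_add_bijective:
  assumes ind: "indecomposable U A"
    and f: "equivariant_linear U A U A f" and g: "equivariant_linear U A U A g"
    and bij: "bij_betw (\<lambda>u. f u + g u) U U"
  shows "bij_betw f U U \<or> bij_betw g U U"
proof -
  have U: "is_rep U A" using ind by (simp add: indecomposable_def)
  have iso: "rep_isomorphism U A U A (\<lambda>u. f u + g u)"
    using equivariant_linear_add[OF f g U] bij by (simp add: rep_isomorphism_def)
  obtain k where k: "equivariant_linear U A U A k"
    and kfg: "\<And>u. u \<in> U \<Longrightarrow> k (f u + g u) = u"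
    using rep_isomorphism_inverse[OF iso is_repD(1,2)[OF U]] by blast
  have kg: "equivariant_linear U A U A (\<lambda>u. k (g u))"
    by (rule equivariant_linear_compose[OF g k])
  from ind equivariant_linear_compose[OF f k] show ?thesis
  proof (cases rule: indecomposable_endomorphism_cases)
    case 1
    then show ?thesis using indecomposable_left_factor_bijective[OF ind f] by blast
  next
    case (2 n)
    have "bij_betw (\<lambda>u. k (g u)) U U"
    proof (rule indecomposable_endomorphism_injective[OF ind kg])
      fix u assume u: "u \<in> U" "k (g u) = 0"
      have "k (f u) = k (f u + g u)"
        using u equivariant_linearD(2)[OF k] equivariant_linearD(1)[OF f] equivariant_linearD(1)[OF g]
        by simp
      then have fix_u: "k (f u) = u" using kfg[OF u(1)] by simp
      have "((\<lambda>u. k (f u)) ^^ m) u = u" for m by (induction m) (auto simp: fix_u)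
      from this[of n] show "u = 0" using 2[OF u(1)] by (rule trans[OF sym])
    qed
    then show ?thesis using indecomposable_left_factor_bijective[OF ind g] by blast
  qed
qed

text \<open>Induction with the two-term case. The empty sum is excluded because the zero map is not
  onto a nonzero space.\<close>

lemma indecomposable_sum_bijective:
  assumes ind: "indecomposable U A" and "finite I"
    and "\<And>i. i \<in> I \<Longrightarrow> equivariant_linear U A U A (f i)"
    and "bij_betw (\<lambda>u. \<Sum>i\<in>I. f i u) U U"
  shows "\<exists>i\<in>I. bij_betw (f i) U U"
proof -
  have U: "is_rep U A" "U \<noteq> {0}" using ind by (auto simp: indecomposable_def)
  from assms(2-4) show ?thesis
  proof (induction I rule: finite_induct)
    case empty
    have "(\<lambda>u. 0) ` U = U" using bij_betw_imp_surj_on[OF empty(2)] by (simp only: sum.empty)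
    then have "U \<subseteq> {0}" by blast
    then show ?case using U(2) subspace_0[OF is_repD(1)[OF U(1)]] by blast
  next
    case (insert a I)
    have fa: "equivariant_linear U A U A (f a)" by (rule insert.prems(1)) simp
    have g: "equivariant_linear U A U A (\<lambda>u. \<Sum>i\<in>I. f i u)"
      by (rule equivariant_linear_sum[OF insert.hyps(1) _ U(1)]) (rule insert.prems(1), simp)
    have "bij_betw (\<lambda>u. f a u + (\<Sum>i\<in>I. f i u)) U U"
      using insert.prems(2) by (simp only: sum.insert[OF insert.hyps] not_False_eq_True)
    from indecomposable_add_bijective[OF ind fa g this] show ?case
      using insert.IH insert.prems(1) by blast
  qed
qed

text \<open>Since \<open>g f\<close> is an automorphism, \<open>W\<close> is the direct sum of the
  image of \<open>f\<close> and the kernel of \<open>g\<close>. The image is nonzero, so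
  indecomposability of \<open>W\<close> kills the kernel and makes \<open>f\<close>
  surjective.\<close>

lemma indecomposable_retract_iso:
  assumes "indecomposable W B" "is_rep U A" "U \<noteq> {0}"
    and "equivariant_linear U A W B f" "equivariant_linear W B U A g"
    and bij: "bij_betw (\<lambda>u. g (f u)) U U"
  shows "rep_iso U A W B"
proof -
  have W: "is_rep W B" using assms(1) by (simp add: indecomposable_def)
  note f = equivariant_linearD[OF assms(4)] and g = equivariant_linearD[OF assms(5)]
  note WD = is_repD[OF W] and UD = is_repD[OF assms(2)]
  let ?I = "f ` U" and ?K = "{w \<in> W. g w = 0}"
  have f0: "f 0 = 0" using f(5) UD(1) by (rule lin_on_zero)
  have g0: "g 0 = 0" using g(5) WD(1) by (rule lin_on_zero)
  have inj: "u = v" if "u \<in> U" "v \<in> U" "g (f u) = g (f v)" for u v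
    using bij that by (auto simp: bij_betw_def inj_on_def)
  have cap: "?I \<inter> ?K = {0}"
    using inj subspace_0[OF UD(1)] subspace_0[OF WD(1)] f0 g0 by force
  have sum: "{x + y |x y. x \<in> ?I \<and> y \<in> ?K} = W"
  proof (intro equalityI subsetI)
    fix w assume w: "w \<in> W"
    then have "g w \<in> (\<lambda>u. g (f u)) ` U" using bij g(1) by (auto simp: bij_betw_def)
    then obtain u where u: "u \<in> U" "g w = g (f u)" by auto
    then have "w - f u \<in> ?K"
      using w f(1) lin_on_diff[OF g(5) WD(1)] subspace_diff[OF WD(1)] by auto
    moreover have "w = f u + (w - f u)" by simp
    ultimately show "w \<in> {x + y |x y. x \<in> ?I \<and> y \<in> ?K}" using u by blast
  qed (use f(1) subspace_add[OF WD(1)] in auto)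
  have "?I \<noteq> {0}"
  proof
    assume "?I = {0}"
    then have "g (f u) = 0" if "u \<in> U" for u using g0 that by (metis imageI singletonD)
    then have "(\<lambda>u. g (f u)) ` U \<subseteq> {0}" by auto
    then show False using bij assms(3) subspace_0[OF UD(1)] by (auto simp: bij_betw_def)
  qed
  then have "?K = {0}"
    using assms(1) is_rep_image[OF assms(2,4) W] is_rep_kernel[OF W assms(5,2)] cap sum
    unfolding indecomposable_def by blast
  then have "?I = W" using sum by auto
  moreover have "inj_on f U" using inj by (auto simp: inj_on_def)
  ultimately show ?thesis
    using assms(4) by (auto simp: rep_iso_def rep_isomorphism_def bij_betw_def)
qed

subsection \<open>Direct sums\<close>

abbreviation sub_sum :: "'u::real_vector set \<Rightarrow> 'u set \<Rightarrow> 'u set" where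
  "sub_sum X Y \<equiv> {x + y | x y. x \<in> X \<and> y \<in> Y}"

text \<open>The ambient representation \<open>E\<close> is what makes \<open>A \<sigma>\<close>
  additive across \<open>X\<close> and \<open>Y\<close>; being representations separately gives
  additivity only within each of them.\<close>

lemma is_rep_sum:
  assumes "is_rep E A" "is_rep X A" "is_rep Y A" "X \<subseteq> E" "Y \<subseteq> E"
  shows "is_rep (sub_sum X Y) A"
proof (rule is_rep_subrep[OF assms(1)])
  note E = is_repD[OF assms(1)] and X = is_repD[OF assms(2)] and Y = is_repD[OF assms(3)]
  show "subspace (sub_sum X Y)" using subspace_sums[OF X(1) Y(1)] .
  show "sub_sum X Y \<subseteq> E" using assms(4,5) subspace_add[OF E(1)] by blast
  fix \<sigma> z assume "z \<in> sub_sum X Y"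
  then obtain x y where xy: "z = x + y" "x \<in> X" "y \<in> Y" by blast
  then have "A \<sigma> z = A \<sigma> x + A \<sigma> y"
    using E(3)[of \<sigma>] assms(4,5) by (auto simp: lin_on_def)
  then show "A \<sigma> z \<in> sub_sum X Y" using xy X(2) Y(2) by blast
qed

lemma direct_sum_projections:
  fixes X Y :: "'u::euclidean_space set" and A :: "'s::monoid_mult \<Rightarrow> 'u \<Rightarrow> 'u"
  assumes X: "is_rep X A" and Y: "is_rep Y A" and Z: "is_rep (sub_sum X Y) A" and cap: "X \<inter> Y = {0}"
  shows "\<exists>p q. equivariant_linear (sub_sum X Y) A X A p \<and> equivariant_linear (sub_sum X Y) A Y A q \<and>
    (\<forall>x\<in>X. \<forall>y\<in>Y. p (x + y) = x \<and> q (x + y) = y)"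
proof -
  note XD = is_repD[OF X] and YD = is_repD[OF Y] and ZD = is_repD[OF Z]
  have uniq: "x = x' \<and> y = y'" if "x \<in> X" "y \<in> Y" "x' \<in> X" "y' \<in> Y" "x + y = x' + y'" for x y x' y'
  proof -
    have eq: "x - x' = y' - y" using that(5) by (simp add: algebra_simps)
    moreover have "x - x' \<in> X" "y' - y \<in> Y"
      using that XD(1) YD(1) by (auto intro: subspace_diff)
    ultimately have "x - x' \<in> X \<inter> Y" by simp
    then have "x - x' = 0" using cap by simp
    then show ?thesis using eq by simp
  qed
  \<comment> \<open>The trivial intersection makes the component in \<open>X\<close> unique, so the
    description denotes it; the other projection is the remainder.\<close>
  define p where "p z = (THE x. x \<in> X \<and> (\<exists>y\<in>Y. z = x + y))" for z
  define q where "q z = z - p z" for z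
  have p: "p (x + y) = x" if "x \<in> X" "y \<in> Y" for x y
    unfolding p_def using that uniq by (intro the_equality) blast+
  then have q: "q (x + y) = y" if "x \<in> X" "y \<in> Y" for x y
    using that by (simp add: q_def)
  have add: "p (z + w) = p z + p w" if zw: "z \<in> sub_sum X Y" "w \<in> sub_sum X Y" for z w
  proof -
    obtain x y x' y' where *: "z = x + y" "w = x' + y'" "x \<in> X" "y \<in> Y" "x' \<in> X" "y' \<in> Y"
      using zw by blast
    have "p ((x + x') + (y + y')) = x + x'"
      using * by (intro p subspace_add XD(1) YD(1))
    then show ?thesis using * p by (simp add: add_ac)
  qed
  have scale: "p (c *\<^sub>R z) = c *\<^sub>R p z" if z: "z \<in> sub_sum X Y" for z c
  proof -
    obtain x y where *: "z = x + y" "x \<in> X" "y \<in> Y" using z by blast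
    have "p (c *\<^sub>R x + c *\<^sub>R y) = c *\<^sub>R x"
      using * by (intro p subspace_scale XD(1) YD(1))
    then show ?thesis using * p by (simp add: scaleR_add_right)
  qed
  have inZ: "x \<in> sub_sum X Y" "y \<in> sub_sum X Y" if "x \<in> X" "y \<in> Y" for x y
    using that subspace_0[OF XD(1)] subspace_0[OF YD(1)] by force+
  have act: "p (A \<sigma> z) = A \<sigma> (p z) \<and> q (A \<sigma> z) = A \<sigma> (q z)" if z: "z \<in> sub_sum X Y" for z \<sigma>
  proof -
    obtain x y where *: "z = x + y" "x \<in> X" "y \<in> Y" using z by blast
    have "A \<sigma> (x + y) = A \<sigma> x + A \<sigma> y"
      using ZD(3)[of \<sigma>] inZ[OF *(2,3)] unfolding lin_on_def by blast
    then show ?thesis using * p q XD(2) YD(2) by simp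
  qed
  have "equivariant_linear (sub_sum X Y) A X A p"
    using p add scale act by (intro equivariant_linearI) auto
  moreover have "equivariant_linear (sub_sum X Y) A Y A q"
  proof (rule equivariant_linearI)
    show "q u \<in> Y" if "u \<in> sub_sum X Y" for u using that q by auto
    show "q (x + y) = q x + q y" if "x \<in> sub_sum X Y" "y \<in> sub_sum X Y" for x y
      unfolding q_def add[OF that] by simp
    show "q (c *\<^sub>R x) = c *\<^sub>R q x" if "x \<in> sub_sum X Y" for c x
      unfolding q_def scale[OF that] by (simp add: scaleR_diff_right)
    show "q (A \<sigma> u) = A \<sigma> (q u)" if "u \<in> sub_sum X Y" for \<sigma> u
      using act[OF that] by blast
  qed
  ultimately show ?thesis using p q by (intro exI[of _ p] exI[of _ q]) simp
qed

text \<open>Strong induction on the dimension: if \<open>C\<close> splits properly as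
  \<open>X\<close> and \<open>Y\<close>, then an indecomposable summand \<open>Z\<close> of
  \<open>X\<close> with complement \<open>D\<close> has the complement \<open>sub_sum D Y\<close> in
  \<open>C\<close>. Splitting off one summand at a time suits the later induction on the
  complement.\<close>

lemma exists_indecomposable_summand:
  fixes C :: "'u::euclidean_space set" and A :: "'s::monoid_mult \<Rightarrow> 'u \<Rightarrow> 'u"
  assumes "is_rep C A" "C \<noteq> {0}"
  shows "\<exists>Y C'. indecomposable Y A \<and> is_rep C' A \<and> Y \<inter> C' = {0} \<and> sub_sum Y C' = C"
  using assms
proof (induction "dim C" arbitrary: C rule: less_induct)
  case less
  note C = less.prems(1) and CD = is_repD[OF less.prems(1)]
  show ?case
  proof (cases "indecomposable C A")
    case True
    have "is_rep {0} A"
      using lin_on_zero[OF CD(3) CD(1)] subspace_0[OF CD(1)]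
      by (intro is_rep_subrep[OF C]) auto
    moreover have "sub_sum C {0} = C" by auto
    ultimately show ?thesis using True subspace_0[OF CD(1)] by blast
  next
    case False
    then obtain X Y where XY: "is_rep X A" "is_rep Y A" "X \<inter> Y = {0}" "sub_sum X Y = C"
      "X \<noteq> {0}" "Y \<noteq> {0}"
      using less.prems unfolding indecomposable_def by blast
    have sub: "X \<subseteq> C" "Y \<subseteq> C"
      using subspace_0[OF is_repD(1)[OF XY(1)]] subspace_0[OF is_repD(1)[OF XY(2)]]
      unfolding XY(4)[symmetric] by force+
    have "dim X < dim C"
    proof (rule ccontr)
      assume "\<not> dim X < dim C"
      then have "X = C"
        using subspace_dim_equal[OF is_repD(1)[OF XY(1)] CD(1) sub(1)] by simp
      then show False using sub(2) XY(3,6) by auto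
    qed
    from less.hyps[OF this XY(1,5)] obtain Z D where
      ZD: "indecomposable Z A" "is_rep D A" "Z \<inter> D = {0}" "sub_sum Z D = X" by blast
    have Z: "is_rep Z A" using ZD(1) by (simp add: indecomposable_def)
    have subX: "Z \<subseteq> X" "D \<subseteq> X"
      using subspace_0[OF is_repD(1)[OF Z]] subspace_0[OF is_repD(1)[OF ZD(2)]]
      unfolding ZD(4)[symmetric] by force+
    have rep: "is_rep (sub_sum D Y) A"
      using is_rep_sum[OF C ZD(2) XY(2)] subX sub by blast
    have "Z \<inter> sub_sum D Y = {0}"
    proof -
      have "z = 0" if z: "z \<in> Z" "d \<in> D" "y \<in> Y" "z = d + y" for z d y
      proof -
        have "y = z - d" using z by simp
        then have "y \<in> X" using z subX is_repD(1)[OF XY(1)] subspace_diff by blast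
        then have "y = 0" using z XY(3) by blast
        then show "z = 0" using z ZD(3) by auto
      qed
      then show ?thesis
        using subspace_0[OF is_repD(1)[OF Z]] subspace_0[OF is_repD(1)[OF rep]] by blast
    qed
    moreover have "sub_sum Z (sub_sum D Y) = C"
      unfolding XY(4)[symmetric] ZD(4)[symmetric]
      by (safe; metis (mono_tags, lifting) add.assoc mem_Collect_eq)
    ultimately show ?thesis using ZD(1) rep by blast
  qed
qed

text \<open>The exchange argument of the Krull-Schmidt theorem: the identity of \<open>Y\<close> is
  a finite sum of the \<open>\<beta> j \<alpha> j\<close>, so by locality one of these is an
  automorphism. Then \<open>Y\<close> is a nonzero retract of the indecomposable \<open>V j\<close>
  and hence all of it.\<close>

lemma indecomposable_factor_iso:
  assumes "indecomposable Y A" "finite J"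
    and "\<And>j. j \<in> J \<Longrightarrow> indecomposable (V j) B"
    and \<alpha>: "\<And>j. j \<in> J \<Longrightarrow> equivariant_linear Y A (V j) B (\<alpha> j)"
    and \<beta>: "\<And>j. j \<in> J \<Longrightarrow> equivariant_linear (V j) B Y A (\<beta> j)"
    and id: "\<And>y. y \<in> Y \<Longrightarrow> (\<Sum>j\<in>J. \<beta> j (\<alpha> j y)) = y"
  shows "\<exists>j\<in>J. rep_iso Y A (V j) B"
proof -
  have Y: "is_rep Y A" "Y \<noteq> {0}" using assms(1) by (auto simp: indecomposable_def)
  have "bij_betw (\<lambda>y. \<Sum>j\<in>J. \<beta> j (\<alpha> j y)) Y Y"
    using id bij_betw_id[of Y] by (simp cong: bij_betw_cong add: id_def)
  then obtain j where j: "j \<in> J" "bij_betw (\<lambda>y. \<beta> j (\<alpha> j y)) Y Y"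
    using indecomposable_sum_bijective[OF assms(1,2), of "\<lambda>j y. \<beta> j (\<alpha> j y)"]
      equivariant_linear_compose[OF \<alpha> \<beta>] by blast
  then show ?thesis
    using indecomposable_retract_iso[OF assms(3) Y \<alpha> \<beta>] by blast
qed

text \<open>The biproduct form of a direct sum, with inclusions \<open>e\<close> and projections
  \<open>\<pi>\<close>. It can be transported by composing single maps, whereas in
  \<open>iso_direct_sum\<close> the projections are hidden in the bijectivity of one map on
  families.\<close>

definition direct_sum_maps ::
    "'u::euclidean_space set \<Rightarrow> ('s \<Rightarrow> 'u \<Rightarrow> 'u) \<Rightarrow> 'i set \<Rightarrow> ('i \<Rightarrow> 'w::euclidean_space set) \<Rightarrow>
     ('s \<Rightarrow> 'w \<Rightarrow> 'w) \<Rightarrow> ('i \<Rightarrow> 'w \<Rightarrow> 'u) \<Rightarrow> ('i \<Rightarrow> 'u \<Rightarrow> 'w) \<Rightarrow> bool" where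
  "direct_sum_maps U A P V B e \<pi> \<longleftrightarrow>
     (\<forall>p\<in>P. equivariant_linear (V p) B U A (e p) \<and> equivariant_linear U A (V p) B (\<pi> p)) \<and>
     (\<forall>p\<in>P. \<forall>q\<in>P. \<forall>w\<in>V q. \<pi> p (e q w) = (if p = q then w else 0)) \<and>
     (\<forall>u\<in>U. (\<Sum>p\<in>P. e p (\<pi> p u)) = u)"

lemma direct_sum_mapsD:
  assumes "direct_sum_maps U A P V B e \<pi>"
  shows "p \<in> P \<Longrightarrow> equivariant_linear (V p) B U A (e p)"
    and "p \<in> P \<Longrightarrow> equivariant_linear U A (V p) B (\<pi> p)"
    and "p \<in> P \<Longrightarrow> q \<in> P \<Longrightarrow> w \<in> V q \<Longrightarrow> \<pi> p (e q w) = (if p = q then w else 0)"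
    and "u \<in> U \<Longrightarrow> (\<Sum>p\<in>P. e p (\<pi> p u)) = u"
  using assms by (simp_all add: direct_sum_maps_def)

abbreviation copies :: "nat \<Rightarrow> (nat \<Rightarrow> nat) \<Rightarrow> (nat \<times> nat) set" where
  "copies N m \<equiv> Sigma {..<N} (\<lambda>i. {..<m i})"

lemma direct_sum_maps_bij:
  assumes D: "direct_sum_maps U A P V B e \<pi>" and "finite P" and U: "is_rep U A"
  shows "bij_betw (\<lambda>x. \<Sum>p\<in>P. e p (x p)) (\<Pi>\<^sub>E p\<in>P. V p) U"
proof (rule bij_betwI[where g = "\<lambda>u. \<lambda>p\<in>P. \<pi> p u"])
  note UD = is_repD[OF U]
  have e: "equivariant_linear (V p) B U A (e p)" and \<pi>: "equivariant_linear U A (V p) B (\<pi> p)"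
    if "p \<in> P" for p using D that by (auto simp: direct_sum_maps_def)
  show "(\<lambda>x. \<Sum>p\<in>P. e p (x p)) \<in> (\<Pi>\<^sub>E p\<in>P. V p) \<rightarrow> U"
    using equivariant_linearD(1)[OF e] by (auto intro!: subspace_sum[OF UD(1)])
  show "(\<lambda>u. \<lambda>p\<in>P. \<pi> p u) \<in> U \<rightarrow> (\<Pi>\<^sub>E p\<in>P. V p)"
    using equivariant_linearD(1)[OF \<pi>] by auto
  show "(\<lambda>p\<in>P. \<pi> p (\<Sum>q\<in>P. e q (x q))) = x" if x: "x \<in> (\<Pi>\<^sub>E p\<in>P. V p)" for x
  proof (rule PiE_ext[OF _ x])
    fix p assume p: "p \<in> P"
    have "\<pi> p (\<Sum>q\<in>P. e q (x q)) = (\<Sum>q\<in>P. \<pi> p (e q (x q)))"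
      using lin_on_sum[OF equivariant_linearD(5)[OF \<pi>[OF p]] UD(1) assms(2)]
        equivariant_linearD(1)[OF e] x by (auto simp: PiE_iff)
    also have "\<dots> = (\<Sum>q\<in>P. if p = q then x q else 0)"
      using D p x by (intro sum.cong) (auto simp: direct_sum_maps_def PiE_iff)
    finally show "(\<lambda>p\<in>P. \<pi> p (\<Sum>q\<in>P. e q (x q))) p = x p" using p assms(2) by simp
  next
    have "(\<Sum>q\<in>P. e q (x q)) \<in> U"
      using equivariant_linearD(1)[OF e] x by (auto intro!: subspace_sum[OF UD(1)] simp: PiE_iff)
    then show "(\<lambda>p\<in>P. \<pi> p (\<Sum>q\<in>P. e q (x q))) \<in> (\<Pi>\<^sub>E p\<in>P. V p)"
      using equivariant_linearD(1)[OF \<pi>] by auto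
  qed
  show "(\<Sum>p\<in>P. e p ((\<lambda>p\<in>P. \<pi> p u) p)) = u" if "u \<in> U" for u
    using D that by (simp add: direct_sum_maps_def)
qed

text \<open>The projections are the coordinates of the inverse bijection. Their linearity and
  equivariance come from the uniqueness of coordinates.\<close>

lemma bij_direct_sum_maps:
  assumes e: "\<And>p. p \<in> P \<Longrightarrow> equivariant_linear (V p) B U A (e p)" and "finite P"
    and U: "is_rep U A" and V: "\<And>p. p \<in> P \<Longrightarrow> is_rep (V p) B"
    and bij: "bij_betw (\<lambda>x. \<Sum>p\<in>P. e p (x p)) (\<Pi>\<^sub>E p\<in>P. V p) U"
  shows "\<exists>\<pi>. direct_sum_maps U A P V B e \<pi>"
proof -
  let ?F = "\<lambda>x. \<Sum>p\<in>P. e p (x p)" and ?D = "\<Pi>\<^sub>E p\<in>P. V p"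
  let ?\<pi> = "\<lambda>p u. inv_into ?D ?F u p"
  note UD = is_repD[OF U] and eD = equivariant_linearD[OF e]
  \<comment> \<open>Every identity for \<open>?\<pi>\<close> below is reduced to exhibiting a family
    of coordinates that sums to the right vector. The family may be arbitrary outside
    \<open>P\<close>, since only its restriction enters.\<close>
  have coord: "?\<pi> p u = x p" if "p \<in> P" "\<And>p. p \<in> P \<Longrightarrow> x p \<in> V p" "u = (\<Sum>p\<in>P. e p (x p))" for p u x
  proof -
    have "restrict x P \<in> ?D" using that(2) by auto
    from bij_betw_inv_into_left[OF bij this] have "inv_into ?D ?F (?F (restrict x P)) = restrict x P" .
    moreover have "?F (restrict x P) = u" using that(3) by simp
    ultimately have "inv_into ?D ?F u = restrict x P" by (simp only:)
    then show ?thesis using that(1) by simp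
  qed
  have V\<pi>: "?\<pi> p u \<in> V p" if "p \<in> P" "u \<in> U" for p u
  proof -
    have "inv_into ?D ?F u \<in> ?D"
      using bij_betw_apply[OF bij_betw_inv_into[OF bij] that(2)] .
    then show ?thesis using that(1) by (rule PiE_mem)
  qed
  have sum: "(\<Sum>p\<in>P. e p (?\<pi> p u)) = u" if "u \<in> U" for u
    using bij_betw_inv_into_right[OF bij that] .
  have "equivariant_linear U A (V p) B (?\<pi> p)" if p: "p \<in> P" for p
  proof (rule equivariant_linearI)
    show "?\<pi> p (u + v) = ?\<pi> p u + ?\<pi> p v" if "u \<in> U" "v \<in> U" for u v
    proof (rule coord[OF p])
      show "?\<pi> q u + ?\<pi> q v \<in> V q" if "q \<in> P" for q
        using V\<pi> that \<open>u \<in> U\<close> \<open>v \<in> U\<close> subspace_add[OF is_repD(1)[OF V]] by blast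
      show "u + v = (\<Sum>q\<in>P. e q (?\<pi> q u + ?\<pi> q v))"
      proof -
        have "(\<Sum>q\<in>P. e q (?\<pi> q u + ?\<pi> q v)) = (\<Sum>q\<in>P. e q (?\<pi> q u) + e q (?\<pi> q v))"
          using V\<pi> that by (intro sum.cong refl eD(2))
        then show ?thesis unfolding sum.distrib sum[OF that(1)] sum[OF that(2)] by (rule sym)
      qed
    qed
    show "?\<pi> p (c *\<^sub>R u) = c *\<^sub>R ?\<pi> p u" if "u \<in> U" for u c
    proof (rule coord[OF p])
      show "c *\<^sub>R ?\<pi> q u \<in> V q" if "q \<in> P" for q
        using V\<pi> that \<open>u \<in> U\<close> subspace_scale[OF is_repD(1)[OF V]] by blast
      show "c *\<^sub>R u = (\<Sum>q\<in>P. e q (c *\<^sub>R ?\<pi> q u))"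
      proof -
        have "(\<Sum>q\<in>P. e q (c *\<^sub>R ?\<pi> q u)) = (\<Sum>q\<in>P. c *\<^sub>R e q (?\<pi> q u))"
          using V\<pi> that by (intro sum.cong refl eD(3))
        then show ?thesis unfolding scaleR_sum_right[symmetric] sum[OF that] by (rule sym)
      qed
    qed
    show "?\<pi> p (A \<sigma> u) = B \<sigma> (?\<pi> p u)" if "u \<in> U" for \<sigma> u
    proof (rule coord[OF p])
      show "B \<sigma> (?\<pi> q u) \<in> V q" if "q \<in> P" for q
        using V\<pi> that \<open>u \<in> U\<close> is_repD(2)[OF V] by blast
      have "A \<sigma> u = A \<sigma> (\<Sum>q\<in>P. e q (?\<pi> q u))" unfolding sum[OF that] ..
      also have "\<dots> = (\<Sum>q\<in>P. A \<sigma> (e q (?\<pi> q u)))"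
        by (rule lin_on_sum[OF UD(3) UD(1) assms(2)]) (rule eD(1)[OF _ V\<pi>[OF _ that]])
      also have "\<dots> = (\<Sum>q\<in>P. e q (B \<sigma> (?\<pi> q u)))"
        using V\<pi> that by (intro sum.cong refl eD(4)[symmetric])
      finally show "A \<sigma> u = (\<Sum>q\<in>P. e q (B \<sigma> (?\<pi> q u)))" .
    qed
  qed (rule V\<pi>[OF p])
  moreover have "?\<pi> p (e q w) = (if p = q then w else 0)" if "p \<in> P" "q \<in> P" "w \<in> V q" for p q w
  proof (rule coord[of p "\<lambda>p. if p = q then w else 0"])
    show "(if r = q then w else 0) \<in> V r" if "r \<in> P" for r
      using that \<open>w \<in> V q\<close> subspace_0[OF is_repD(1)[OF V]] by auto
    have "(\<Sum>r\<in>P. e r (if r = q then w else 0)) = (\<Sum>r\<in>P. if r = q then e r w else 0)"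
      using lin_on_zero[OF eD(5) is_repD(1)[OF V]] by (intro sum.cong) auto
    then show "e q w = (\<Sum>r\<in>P. e r (if r = q then w else 0))" using \<open>q \<in> P\<close> assms(2) by simp
  qed (rule that(1))
  ultimately show ?thesis
    unfolding direct_sum_maps_def by (intro exI[of _ ?\<pi>] conjI ballI e sum)
qed

lemma iso_direct_sum_iff:
  assumes "is_rep U A" "\<forall>i<N. is_rep (W i) B"
  shows "iso_direct_sum U A N W B m \<longleftrightarrow> (\<exists>e \<pi>. direct_sum_maps U A (copies N m) (\<lambda>p. W (fst p)) B e \<pi>)"
proof
  assume "iso_direct_sum U A N W B m"
  then obtain e where
    "\<forall>p \<in> copies N m. equivariant_linear (W (fst p)) B U A (e p)"
    "bij_betw (\<lambda>x. \<Sum>p\<in>copies N m. e p (x p)) (\<Pi>\<^sub>E p\<in>copies N m. W (fst p)) U"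
    unfolding iso_direct_sum_def by blast
  then have "\<exists>\<pi>. direct_sum_maps U A (copies N m) (\<lambda>p. W (fst p)) B e \<pi>"
    using assms by (intro bij_direct_sum_maps) auto
  then show "\<exists>e \<pi>. direct_sum_maps U A (copies N m) (\<lambda>p. W (fst p)) B e \<pi>" by blast
next
  assume "\<exists>e \<pi>. direct_sum_maps U A (copies N m) (\<lambda>p. W (fst p)) B e \<pi>"
  then obtain e \<pi> where D: "direct_sum_maps U A (copies N m) (\<lambda>p. W (fst p)) B e \<pi>" by blast
  show "iso_direct_sum U A N W B m"
    unfolding iso_direct_sum_def
    using direct_sum_maps_bij[OF D _ assms(1)] D
    by (intro exI[of _ e] conjI) (auto simp: direct_sum_maps_def)
qed

section \<open>Transport and enlargement of direct sum decompositions\<close>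

lemma iso_direct_sum_rep_iso:
  assumes "iso_direct_sum U A N W B m" "rep_iso U A U' A'" "is_rep U A"
    and "\<forall>i<N. is_rep (W i) B"
  shows "iso_direct_sum U' A' N W B m"
proof -
  obtain \<phi> \<psi> where iso: "rep_isomorphism U A U' A' \<phi>"
    and \<phi>: "equivariant_linear U A U' A' \<phi>" and \<psi>: "equivariant_linear U' A' U A \<psi>"
    and inv: "\<forall>u\<in>U. \<psi> (\<phi> u) = u" "\<forall>w\<in>U'. \<phi> (\<psi> w) = w"
    using rep_isoE[OF assms(2,3)] by metis
  have U': "is_rep U' A'" using is_rep_isomorphic[OF iso assms(3)] .
  obtain e \<pi> where D: "direct_sum_maps U A (copies N m) (\<lambda>p. W (fst p)) B e \<pi>"
    using assms(1) iso_direct_sum_iff[OF assms(3,4)] by blast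
  have "direct_sum_maps U' A' (copies N m) (\<lambda>p. W (fst p)) B (\<lambda>p x. \<phi> (e p x)) (\<lambda>p x. \<pi> p (\<psi> x))"
    unfolding direct_sum_maps_def
  proof (intro conjI ballI)
    fix p assume p: "p \<in> copies N m"
    then have e: "equivariant_linear (W (fst p)) B U A (e p)"
      and \<pi>: "equivariant_linear U A (W (fst p)) B (\<pi> p)"
      using D by (auto simp: direct_sum_maps_def)
    show "equivariant_linear (W (fst p)) B U' A' (\<lambda>x. \<phi> (e p x))"
      by (rule equivariant_linear_compose[OF e \<phi>])
    show "equivariant_linear U' A' (W (fst p)) B (\<lambda>x. \<pi> p (\<psi> x))"
      by (rule equivariant_linear_compose[OF \<psi> \<pi>])
  next
    fix p q w assume *: "p \<in> copies N m" "q \<in> copies N m" "w \<in> W (fst q)"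
    then have "e q w \<in> U" using D unfolding direct_sum_maps_def equivariant_linear_def by blast
    then show "\<pi> p (\<psi> (\<phi> (e q w))) = (if p = q then w else 0)"
      using inv(1) direct_sum_mapsD(3)[OF D *] by simp
  next
    fix u assume u: "u \<in> U'"
    then have "\<psi> u \<in> U" using equivariant_linearD(1)[OF \<psi>] by blast
    moreover have "e p (\<pi> p (\<psi> u)) \<in> U" if "p \<in> copies N m" for p
      using D that \<open>\<psi> u \<in> U\<close> unfolding direct_sum_maps_def equivariant_linear_def by blast
    ultimately have "\<phi> (\<Sum>p\<in>copies N m. e p (\<pi> p (\<psi> u))) = (\<Sum>p\<in>copies N m. \<phi> (e p (\<pi> p (\<psi> u))))"
      by (intro lin_on_sum[OF equivariant_linearD(5)[OF \<phi>] is_repD(1)[OF assms(3)]]) auto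
    then show "(\<Sum>p\<in>copies N m. \<phi> (e p (\<pi> p (\<psi> u)))) = u"
      using D \<open>\<psi> u \<in> U\<close> inv(2) u unfolding direct_sum_maps_def by simp
  qed
  then show ?thesis using iso_direct_sum_iff[OF U' assms(4)] by blast
qed

text \<open>This moves the model summands from the smaller phase space to subspaces of the larger
  one, for the decomposition of the phase space as well as for that of \<open>U\<close>.\<close>

lemma iso_direct_sum_summands:
  assumes "iso_direct_sum U A N W B m" "is_rep U A"
    and "\<forall>i<N. is_rep (W i) B"
    and "\<forall>i<N. rep_iso (W i) B (W' i) B'"
  shows "iso_direct_sum U A N W' B' m"
proof -
  \<comment> \<open>\<open>Q\<close> bundles an isomorphism with its inverse, so that a matching
    pair can be chosen for all \<open>i < N\<close> at once.\<close>
  define Q where "Q i \<phi> \<psi> \<longleftrightarrow>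
      rep_isomorphism (W i) B (W' i) B' \<phi> \<and> equivariant_linear (W i) B (W' i) B' \<phi> \<and>
      equivariant_linear (W' i) B' (W i) B \<psi> \<and> (\<forall>u\<in>W i. \<psi> (\<phi> u) = u) \<and> (\<forall>w\<in>W' i. \<phi> (\<psi> w) = w)"
    for i \<phi> \<psi>
  have "\<exists>\<phi> \<psi>. Q i \<phi> \<psi>" if i: "i < N" for i
  proof -
    have "rep_iso (W i) B (W' i) B'" "is_rep (W i) B" using assms(3,4) i by auto
    then show ?thesis unfolding Q_def by (rule rep_isoE) blast
  qed
  then obtain \<phi> \<psi> where Q: "\<And>i. i < N \<Longrightarrow> Q i (\<phi> i) (\<psi> i)" by metis
  then have iso: "\<And>i. i < N \<Longrightarrow> rep_isomorphism (W i) B (W' i) B' (\<phi> i)"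
    and \<phi>: "\<And>i. i < N \<Longrightarrow> equivariant_linear (W i) B (W' i) B' (\<phi> i)"
    and \<psi>: "\<And>i. i < N \<Longrightarrow> equivariant_linear (W' i) B' (W i) B (\<psi> i)"
    and inv: "\<And>i u. i < N \<Longrightarrow> u \<in> W i \<Longrightarrow> \<psi> i (\<phi> i u) = u"
      "\<And>i w. i < N \<Longrightarrow> w \<in> W' i \<Longrightarrow> \<phi> i (\<psi> i w) = w"
    unfolding Q_def by blast+
  have W: "is_rep (W i) B" if "i < N" for i using assms(3) that by blast
  have W': "\<forall>i<N. is_rep (W' i) B'" using is_rep_isomorphic[OF iso W] by blast
  obtain e \<pi> where D: "direct_sum_maps U A (copies N m) (\<lambda>p. W (fst p)) B e \<pi>"
    using assms(1) iso_direct_sum_iff[OF assms(2,3)] by blast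
  have "direct_sum_maps U A (copies N m) (\<lambda>p. W' (fst p)) B'
      (\<lambda>p x. e p (\<psi> (fst p) x)) (\<lambda>p x. \<phi> (fst p) (\<pi> p x))"
    unfolding direct_sum_maps_def
  proof (intro conjI ballI)
    fix p assume p: "p \<in> copies N m"
    then have e: "equivariant_linear (W (fst p)) B U A (e p)"
      and \<pi>: "equivariant_linear U A (W (fst p)) B (\<pi> p)" and i: "fst p < N"
      using D by (auto simp: direct_sum_maps_def)
    show "equivariant_linear (W' (fst p)) B' U A (\<lambda>x. e p (\<psi> (fst p) x))"
      by (rule equivariant_linear_compose[OF \<psi>[OF i] e])
    show "equivariant_linear U A (W' (fst p)) B' (\<lambda>x. \<phi> (fst p) (\<pi> p x))"
      by (rule equivariant_linear_compose[OF \<pi> \<phi>[OF i]])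
  next
    fix p q w assume *: "p \<in> copies N m" "q \<in> copies N m" "w \<in> W' (fst q)"
    then have i: "fst p < N" "fst q < N" by auto
    have "\<psi> (fst q) w \<in> W (fst q)" using equivariant_linearD(1)[OF \<psi>[OF i(2)]] * by blast
    then have "\<pi> p (e q (\<psi> (fst q) w)) = (if p = q then \<psi> (fst q) w else 0)"
      using direct_sum_mapsD(3)[OF D *(1,2)] by simp
    moreover have "\<phi> (fst p) 0 = 0"
      by (rule lin_on_zero[OF equivariant_linearD(5)[OF \<phi>[OF i(1)]] is_repD(1)[OF W[OF i(1)]]])
    ultimately show "\<phi> (fst p) (\<pi> p (e q (\<psi> (fst q) w))) = (if p = q then w else 0)"
      using inv(2)[OF i(2)] * by simp
  next
    fix u assume u: "u \<in> U"
    have "(\<Sum>p\<in>copies N m. e p (\<psi> (fst p) (\<phi> (fst p) (\<pi> p u)))) = (\<Sum>p\<in>copies N m. e p (\<pi> p u))"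
    proof (rule sum.cong[OF refl])
      fix p assume p: "p \<in> copies N m"
      then have "\<pi> p u \<in> W (fst p)"
        using D u unfolding direct_sum_maps_def equivariant_linear_def by blast
      then show "e p (\<psi> (fst p) (\<phi> (fst p) (\<pi> p u))) = e p (\<pi> p u)" using inv(1) p by auto
    qed
    then show "(\<Sum>p\<in>copies N m. e p (\<psi> (fst p) (\<phi> (fst p) (\<pi> p u)))) = u"
      using D u unfolding direct_sum_maps_def by simp
  qed
  then show ?thesis using iso_direct_sum_iff[OF assms(2) W'] by blast
qed

text \<open>The new copy of \<open>W j\<close> receives the index \<open>(j, m j)\<close>, the first
  one missing from row \<open>j\<close> of \<open>copies N m\<close>. The old projections are
  precomposed with the projection onto \<open>X\<close>, the new one factors through the projection
  onto \<open>Y\<close>.\<close>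

lemma iso_direct_sum_add_summand:
  fixes X Y :: "'u::euclidean_space set" and A :: "'s::monoid_mult \<Rightarrow> 'u \<Rightarrow> 'u"
  assumes "iso_direct_sum X A N W B m" and X: "is_rep X A" and Y: "is_rep Y A"
    and Z: "is_rep (sub_sum X Y) A" and cap: "X \<inter> Y = {0}"
    and W: "\<forall>i<N. is_rep (W i) B" and j: "j < N" and "rep_iso (W j) B Y A"
  shows "iso_direct_sum (sub_sum X Y) A N W B (m(j := Suc (m j)))"
proof -
  let ?Z = "sub_sum X Y" and ?P = "copies N m" and ?j = "(j, m j)"
  note XD = is_repD[OF X] and YD = is_repD[OF Y]
  obtain \<phi> \<psi> where \<phi>: "equivariant_linear (W j) B Y A \<phi>" and \<psi>: "equivariant_linear Y A (W j) B \<psi>"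
    and inv: "\<forall>u\<in>W j. \<psi> (\<phi> u) = u" "\<forall>w\<in>Y. \<phi> (\<psi> w) = w"
    using rep_isoE[OF assms(8)] W j by metis
  obtain e \<pi> where D: "direct_sum_maps X A ?P (\<lambda>p. W (fst p)) B e \<pi>"
    using assms(1) iso_direct_sum_iff[OF X W] by blast
  obtain p q where p: "equivariant_linear ?Z A X A p" and q: "equivariant_linear ?Z A Y A q"
    and pq_sum: "\<forall>x\<in>X. \<forall>y\<in>Y. p (x + y) = x \<and> q (x + y) = y"
    using direct_sum_projections[OF X Y Z cap] by blast
  have pq: "p (x + y) = x" "q (x + y) = y" if "x \<in> X" "y \<in> Y" for x y
    using pq_sum that by auto
  have X0: "0 \<in> X" and Y0: "0 \<in> Y" using XD(1) YD(1) subspace_0 by auto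
  have pqX: "p x = x" "q x = 0" if "x \<in> X" for x using pq[OF that Y0] by auto
  have pqY: "p y = 0" "q y = y" if "y \<in> Y" for y using pq[OF X0 that] by auto
  have sub: "X \<subseteq> ?Z" "Y \<subseteq> ?Z" using X0 Y0 by force+
  have set: "copies N (m(j := Suc (m j))) = insert ?j ?P"
    using j by (auto simp: less_Suc_eq split: if_splits)
  have jP: "?j \<notin> ?P" by auto
  have e: "equivariant_linear (W (fst r)) B X A (e r)"
    and \<pi>: "equivariant_linear X A (W (fst r)) B (\<pi> r)" if "r \<in> ?P" for r
    using D that by (auto simp: direct_sum_maps_def)
  have \<pi>e: "\<pi> r (e s w) = (if r = s then w else 0)" if "r \<in> ?P" "s \<in> ?P" "w \<in> W (fst s)" for r s w
    by (rule direct_sum_mapsD(3)[OF D that])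
  define e' where "e' = e(?j := \<phi>)"
  define \<pi>' where "\<pi>' = (\<lambda>r x. \<pi> r (p x))(?j := \<lambda>x. \<psi> (q x))"
  have ej: "e' ?j = \<phi>" "\<pi>' ?j = (\<lambda>x. \<psi> (q x))" by (simp_all add: e'_def \<pi>'_def)
  have eP: "e' r = e r" "\<pi>' r = (\<lambda>x. \<pi> r (p x))" if "r \<in> ?P" for r
    using that by (auto simp: e'_def \<pi>'_def)
  have "direct_sum_maps ?Z A (insert ?j ?P) (\<lambda>p. W (fst p)) B e' \<pi>'"
    unfolding direct_sum_maps_def
  proof (intro conjI ballI)
    fix r assume r: "r \<in> insert ?j ?P"
    then consider "r = ?j" | "r \<in> ?P" by blast
    then show "equivariant_linear (W (fst r)) B ?Z A (e' r)"
    proof cases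
      case 1
      then show ?thesis using equivariant_linear_mono[OF \<phi> order_refl sub(2)] ej by simp
    next
      case 2
      then show ?thesis using equivariant_linear_mono[OF e[OF 2] order_refl sub(1)] eP by simp
    qed
    from r consider "r = ?j" | "r \<in> ?P" by blast
    then show "equivariant_linear ?Z A (W (fst r)) B (\<pi>' r)"
    proof cases
      case 1
      then show ?thesis using equivariant_linear_compose[OF q \<psi>] ej by simp
    next
      case 2
      then show ?thesis using equivariant_linear_compose[OF p \<pi>[OF 2]] eP by simp
    qed
  next
    fix r s w assume r: "r \<in> insert ?j ?P" and s: "s \<in> insert ?j ?P" and w: "w \<in> W (fst s)"
    have \<psi>0: "\<psi> 0 = 0" using lin_on_zero[OF equivariant_linearD(5)[OF \<psi>] YD(1)] .
    have \<pi>0: "\<pi> r 0 = 0" if "r \<in> ?P" for r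
      using lin_on_zero[OF equivariant_linearD(5)[OF \<pi>[OF that]] XD(1)] .
    show "\<pi>' r (e' s w) = (if r = s then w else 0)"
    proof (cases "s = ?j")
      case True
      then have "\<phi> w \<in> Y" "w \<in> W j" using w equivariant_linearD(1)[OF \<phi>] by auto
      then show ?thesis
        using True r jP ej eP \<pi>0 inv(1) pqY by (cases "r = ?j") auto
    next
      case False
      then have s': "s \<in> ?P" using s by blast
      then have "e s w \<in> X" using equivariant_linearD(1)[OF e[OF s']] w by auto
      then show ?thesis
        using False s' r jP ej eP \<pi>e[OF _ s' w] \<psi>0 pqX by (cases "r = ?j") auto
    qed
  next
    fix z assume "z \<in> ?Z"
    then obtain x y where z: "z = x + y" "x \<in> X" "y \<in> Y" by blast
    have "(\<Sum>r\<in>insert ?j ?P. e' r (\<pi>' r z)) = \<phi> (\<psi> (q z)) + (\<Sum>r\<in>?P. e' r (\<pi>' r z))"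
      using jP ej by simp
    also have "(\<Sum>r\<in>?P. e' r (\<pi>' r z)) = (\<Sum>r\<in>?P. e r (\<pi> r (p z)))"
      using eP by (intro sum.cong) auto
    also have "\<dots> = x" using direct_sum_mapsD(4)[OF D z(2)] z pq(1) by simp
    also have "\<phi> (\<psi> (q z)) = y" using z pq(2) inv(2) by simp
    finally show "(\<Sum>r\<in>insert ?j ?P. e' r (\<pi>' r z)) = z" using z by (simp add: add.commute)
  qed
  then have "\<exists>e \<pi>. direct_sum_maps ?Z A (copies N (m(j := Suc (m j)))) (\<lambda>p. W (fst p)) B e \<pi>"
    unfolding set by blast
  then show ?thesis by (simp only: iso_direct_sum_iff[OF Z W])
qed

text \<open>Induction on the dimension of \<open>C\<close>: an indecomposable summand
  \<open>Y\<close> of \<open>C\<close> is moved over to \<open>X\<close>, where it raises one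
  multiplicity. The retraction \<open>\<rho>\<close> of \<open>E\<close> onto \<open>C\<close> is
  carried along because \<open>summands\<close> recognizes only those indecomposables that are
  retracts of \<open>E\<close>.\<close>

lemma iso_direct_sum_add_complement:
  fixes E X C :: "'u::euclidean_space set" and A :: "'s::monoid_mult \<Rightarrow> 'u \<Rightarrow> 'u"
  assumes E: "is_rep E A" and W: "\<forall>i<N. is_rep (W i) B"
    and summands: "\<And>Y \<rho>. indecomposable Y A \<Longrightarrow> Y \<subseteq> E \<Longrightarrow> equivariant_linear E A Y A \<rho> \<Longrightarrow>
      (\<And>y. y \<in> Y \<Longrightarrow> \<rho> y = y) \<Longrightarrow> \<exists>i<N. rep_iso (W i) B Y A"
    and "iso_direct_sum X A N W B s" "is_rep X A" "X \<subseteq> E" "is_rep C A" "C \<subseteq> E" "X \<inter> C = {0}"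
    and "equivariant_linear E A C A \<rho>" "\<And>c. c \<in> C \<Longrightarrow> \<rho> c = c"
  shows "\<exists>q. (\<forall>i<N. s i \<le> q i) \<and> iso_direct_sum (sub_sum X C) A N W B q"
  using assms(4-)
proof (induction "dim C" arbitrary: X C s \<rho> rule: less_induct)
  case less
  note CD = is_repD[OF less.prems(4)]
  show ?case
  proof (cases "C = {0}")
    case True
    then have "sub_sum X C = X" by auto
    then show ?thesis using less.prems(1) by auto
  next
    case False
    then obtain Y C' where Y: "indecomposable Y A" and C': "is_rep C' A" and cap: "Y \<inter> C' = {0}"
      and C: "sub_sum Y C' = C"
      using exists_indecomposable_summand[OF less.prems(4) False] by blast
    have Yr: "is_rep Y A" "Y \<noteq> {0}" using Y by (auto simp: indecomposable_def)
    note YD = is_repD[OF Yr(1)] and C'D = is_repD[OF C'] and XD = is_repD[OF less.prems(2)]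
    have sub: "Y \<subseteq> C" "C' \<subseteq> C"
      using subspace_0[OF YD(1)] subspace_0[OF C'D(1)] unfolding C[symmetric] by force+
    obtain p q where p: "equivariant_linear C A Y A p" and q: "equivariant_linear C A C' A q"
      and pq_sum: "\<forall>x\<in>Y. \<forall>y\<in>C'. p (x + y) = x \<and> q (x + y) = y"
      using direct_sum_projections[OF Yr(1) C' _ cap] less.prems(4) unfolding C by blast
    have pq: "p (x + y) = x" "q (x + y) = y" if "x \<in> Y" "y \<in> C'" for x y
      using pq_sum that by auto
    have pY: "p y = y" if "y \<in> Y" for y using pq(1)[OF that subspace_0[OF C'D(1)]] by simp
    have qC': "q y = y" if "y \<in> C'" for y using pq(2)[OF subspace_0[OF YD(1)] that] by simp
    have "Y \<subseteq> E" using sub less.prems(5) by blast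
    \<comment> \<open>Following \<open>\<rho>\<close> by the projections of \<open>C\<close> yields
      retractions of \<open>E\<close> onto \<open>Y\<close> and onto \<open>C'\<close>: the first is
      what \<open>summands\<close> asks for, the second what the induction hypothesis asks
      for.\<close>
    moreover have "p (\<rho> y) = y" if "y \<in> Y" for y using less.prems(8) sub that pY by auto
    ultimately obtain j where j: "j < N" "rep_iso (W j) B Y A"
      using summands[OF Y _ equivariant_linear_compose[OF less.prems(7) p]] by blast
    have XY: "is_rep (sub_sum X Y) A"
      using is_rep_sum[OF E less.prems(2) Yr(1)] less.prems(3,5) sub by blast
    have "X \<inter> Y = {0}"
      using less.prems(6) sub subspace_0[OF YD(1)] subspace_0[OF XD(1)] by auto
    then have ids: "iso_direct_sum (sub_sum X Y) A N W B (s(j := Suc (s j)))"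
      using iso_direct_sum_add_summand[OF less.prems(1,2) Yr(1) XY _ W j] by blast
    have "dim C' < dim C"
    proof (rule ccontr)
      assume "\<not> dim C' < dim C"
      then have "C' = C" using subspace_dim_equal[OF C'D(1) CD(1) sub(2)] by simp
      then show False using sub(1) cap Yr(2) by auto
    qed
    note hyp = less.hyps[OF this ids XY _ C']
    have "sub_sum X Y \<subseteq> E"
      using less.prems(3,5) sub subspace_add[OF is_repD(1)[OF E]] by blast
    moreover have "C' \<subseteq> E" using sub less.prems(5) by blast
    moreover have "sub_sum X Y \<inter> C' = {0}"
    proof -
      have "c = 0" if "x \<in> X" "y \<in> Y" "c \<in> C'" "c = x + y" for x y c
      proof -
        have "x = c - y" using that by simp
        then have "x \<in> C" using that sub CD(1) subspace_diff by blast
        then have "x = 0" using that less.prems(6) by blast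
        then show ?thesis using that cap by auto
      qed
      then show ?thesis
        using subspace_0[OF is_repD(1)[OF XY]] subspace_0[OF C'D(1)] by blast
    qed
    moreover have "q (\<rho> c) = c" if "c \<in> C'" for c
      using that sub less.prems(8) qC' by auto
    ultimately obtain r where r: "\<forall>i<N. (s(j := Suc (s j))) i \<le> r i"
      "iso_direct_sum (sub_sum (sub_sum X Y) C') A N W B r"
      using hyp[OF _ _ _ equivariant_linear_compose[OF less.prems(7) q]] by blast
    have "s i \<le> r i" if "i < N" for i
    proof -
      have "(s(j := Suc (s j))) i \<le> r i" using r(1) that by blast
      then show ?thesis by (auto split: if_splits)
    qed
    moreover have "sub_sum (sub_sum X Y) C' = sub_sum X C"
      unfolding C[symmetric]
      by (safe; metis (mono_tags, lifting) add.assoc mem_Collect_eq)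
    ultimately show ?thesis using r(2) by auto
  qed
qed

subsection \<open>Invariance of the type under isomorphism\<close>

lemma ring_iso_inverse:
  assumes "ring R" "h \<in> ring_iso R S"
  obtains g where "g \<in> ring_iso S R" "\<And>x. x \<in> carrier R \<Longrightarrow> g (h x) = x"
    "\<And>y. y \<in> carrier S \<Longrightarrow> h (g y) = y"
proof (rule that[of "inv_into (carrier R) h"])
  have b: "bij_betw h (carrier R) (carrier S)" using assms(2) by (simp add: ring_iso_def)
  show "inv_into (carrier R) h \<in> ring_iso S R" using ring_iso_set_sym[OF assms] .
  show "inv_into (carrier R) h (h x) = x" if "x \<in> carrier R" for x
    using b that by (simp add: bij_betw_inv_into_left)
  show "h (inv_into (carrier R) h y) = y" if "y \<in> carrier S" for y
    using b that by (simp add: bij_betw_inv_into_right)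
qed

lemma left_ideal_image:
  assumes "ring R" "ring S" "h \<in> ring_iso R S" "left_ideal R I"
  shows "left_ideal S (h ` I)"
proof -
  have hom: "h \<in> ring_hom R S" and onto: "h ` carrier R = carrier S"
    using assms(3) by (auto simp: ring_iso_def bij_betw_def)
  interpret h: ring_hom_ring R S h
    using assms(1,2) hom by (rule ring_hom_ringI2)
  have I: "additive_subgroup I R" "\<And>r x. r \<in> carrier R \<Longrightarrow> x \<in> I \<Longrightarrow> r \<otimes>\<^bsub>R\<^esub> x \<in> I"
    using assms(4) by (auto simp: left_ideal_def)
  have sub: "I \<subseteq> carrier R" using I(1) by (rule additive_subgroup.a_subset)
  have "additive_subgroup (h ` I) S"
    using group_hom.subgroup_img_is_subgroup[OF h.a_group_hom additive_subgroup.a_subgroup[OF I(1)]]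
    by (rule additive_subgroupI)
  moreover have "s \<otimes>\<^bsub>S\<^esub> y \<in> h ` I" if "s \<in> carrier S" "y \<in> h ` I" for s y
  proof -
    obtain r x where "r \<in> carrier R" "s = h r" "x \<in> I" "y = h x"
      using \<open>s \<in> carrier S\<close> \<open>y \<in> h ` I\<close> unfolding onto[symmetric] by blast
    then have "s \<otimes>\<^bsub>S\<^esub> y = h (r \<otimes>\<^bsub>R\<^esub> x)" using sub by auto
    then show ?thesis using I(2) \<open>r \<in> carrier R\<close> \<open>x \<in> I\<close> by blast
  qed
  ultimately show ?thesis by (simp add: left_ideal_def)
qed

lemma left_ideal_subset: "left_ideal R I \<Longrightarrow> I \<subseteq> carrier R"
  by (simp add: left_ideal_def additive_subgroup.a_subset)

text \<open>A left ideal of \<open>S\<close> above the image of \<open>M\<close> is pulled back by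
  the inverse \<open>g\<close> to a left ideal above \<open>M\<close>, where maximality leaves only
  two possibilities.\<close>

lemma maximal_left_ideal_image:
  assumes "ring R" "ring S" "h \<in> ring_iso R S" "maximal_left_ideal R M"
  shows "maximal_left_ideal S (h ` M)"
proof -
  have onto: "h ` carrier R = carrier S" and inj: "inj_on h (carrier R)"
    using assms(3) by (auto simp: ring_iso_def bij_betw_def)
  obtain g where g: "g \<in> ring_iso S R" and gh: "\<And>x. x \<in> carrier R \<Longrightarrow> g (h x) = x"
    and hg: "\<And>y. y \<in> carrier S \<Longrightarrow> h (g y) = y"
    using ring_iso_inverse[OF assms(1,3)] by metis
  have M: "left_ideal R M" "M \<noteq> carrier R"
    and max: "\<And>I. left_ideal R I \<Longrightarrow> M \<subseteq> I \<Longrightarrow> I = M \<or> I = carrier R"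
    using assms(4) by (auto simp: maximal_left_ideal_def)
  have "h ` M \<noteq> carrier S"
    using M(2) inj_on_image_eq_iff[OF inj left_ideal_subset[OF M(1)] order_refl] onto by auto
  moreover have "I = h ` M \<or> I = carrier S" if I: "left_ideal S I" "h ` M \<subseteq> I" for I
  proof -
    have hgI: "h ` g ` I = I"
      using left_ideal_subset[OF I(1)] hg by (force simp: image_image)
    have "M \<subseteq> g ` I"
    proof
      fix x assume "x \<in> M"
      then have "g (h x) = x" "h x \<in> I" using gh left_ideal_subset[OF M(1)] I(2) by auto
      then show "x \<in> g ` I" by (metis imageI)
    qed
    then have "g ` I = M \<or> g ` I = carrier R"
      using max left_ideal_image[OF assms(2,1) g I(1)] by blast
    then show ?thesis using hgI onto by metis
  qed
  ultimately show ?thesis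
    using left_ideal_image[OF assms(1-3) M(1)] by (simp add: maximal_left_ideal_def)
qed

lemma jacobson_radical_subset: "jacobson_radical R \<subseteq> carrier R"
  by (auto simp: jacobson_radical_def)

text \<open>The inverse carries a maximal left ideal \<open>M\<close> of \<open>S\<close> to a
  maximal left ideal of \<open>R\<close>. That one contains \<open>x\<close>, so \<open>M\<close>
  contains \<open>h x\<close>.\<close>

lemma jacobson_radical_image_subset:
  assumes "ring R" "ring S" "h \<in> ring_iso R S"
  shows "h ` jacobson_radical R \<subseteq> jacobson_radical S"
proof
  fix y assume "y \<in> h ` jacobson_radical R"
  then obtain x where x: "x \<in> carrier R" "\<And>M. maximal_left_ideal R M \<Longrightarrow> x \<in> M" "y = h x"
    by (auto simp: jacobson_radical_def)
  obtain g where g: "g \<in> ring_iso S R" and hg: "\<And>y. y \<in> carrier S \<Longrightarrow> h (g y) = y"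
    using ring_iso_inverse[OF assms(1,3)] by metis
  have "y \<in> M" if M: "maximal_left_ideal S M" for M
  proof -
    have "x \<in> g ` M" using x(2) maximal_left_ideal_image[OF assms(2,1) g M] by blast
    moreover have "M \<subseteq> carrier S" using M left_ideal_subset by (auto simp: maximal_left_ideal_def)
    ultimately show ?thesis using hg x(3) by auto
  qed
  moreover have "y \<in> carrier S"
    using assms(3) x by (auto simp: ring_iso_def bij_betw_def)
  ultimately show "y \<in> jacobson_radical S" by (simp add: jacobson_radical_def)
qed

lemma jacobson_radical_image:
  assumes "ring R" "ring S" "h \<in> ring_iso R S"
  shows "h ` jacobson_radical R = jacobson_radical S"
proof
  obtain g where g: "g \<in> ring_iso S R" and hg: "\<And>y. y \<in> carrier S \<Longrightarrow> h (g y) = y"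
    using ring_iso_inverse[OF assms(1,3)] by metis
  show "jacobson_radical S \<subseteq> h ` jacobson_radical R"
  proof
    fix y assume y: "y \<in> jacobson_radical S"
    then have "g y \<in> jacobson_radical R"
      using jacobson_radical_image_subset[OF assms(2,1) g] by blast
    moreover have "h (g y) = y" using hg subsetD[OF jacobson_radical_subset y] by blast
    ultimately show "y \<in> h ` jacobson_radical R" by (intro image_eqI[of y h "g y"]) simp_all
  qed
qed (rule jacobson_radical_image_subset[OF assms])

lemma ring_iso_image_coset:
  assumes "ring R" "h \<in> ring_iso R S" "I \<subseteq> carrier R" "x \<in> carrier R"
  shows "h ` (I +>\<^bsub>R\<^esub> x) = h ` I +>\<^bsub>S\<^esub> h x"
proof -
  have add: "h (a \<oplus>\<^bsub>R\<^esub> x) = h a \<oplus>\<^bsub>S\<^esub> h x" if "a \<in> I" for a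
    using assms(2-4) that by (auto simp: ring_iso_def ring_hom_def)
  show ?thesis by (simp add: a_r_coset_def' image_UN add)
qed

text \<open>The subset I need not be an ideal, as this is pure transport of structure; in particular it
  is not necessary to know that the radical is a two-sided ideal.\<close>

lemma ring_iso_image_quotient:
  assumes "ring R" "h \<in> ring_iso R S" "I \<subseteq> carrier R"
  shows "(`) h \<in> ring_iso (R Quot I) (S Quot (h ` I))"
proof -
  interpret ring R by fact
  have onto: "h ` carrier R = carrier S" and inj: "inj_on h (carrier R)"
    using assms(2) by (auto simp: ring_iso_def bij_betw_def)
  have mult: "h (a \<otimes>\<^bsub>R\<^esub> b) = h a \<otimes>\<^bsub>S\<^esub> h b" and add: "h (a \<oplus>\<^bsub>R\<^esub> b) = h a \<oplus>\<^bsub>S\<^esub> h b"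
    if "a \<in> carrier R" "b \<in> carrier R" for a b
    using assms(2) that by (auto simp: ring_iso_def ring_hom_def)
  have one: "h \<one>\<^bsub>R\<^esub> = \<one>\<^bsub>S\<^esub>" using assms(2) by (auto simp: ring_iso_def ring_hom_def)
  note coset = ring_iso_image_coset[OF assms]
  have carr: "carrier (R Quot I) = (+>\<^bsub>R\<^esub>) I ` carrier R" "carrier (S Quot (h ` I)) = (+>\<^bsub>S\<^esub>) (h ` I) ` carrier S"
    by (auto simp: FactRing_def A_RCOSETS_def')
  have sub: "X \<subseteq> carrier R" if "X \<in> carrier (R Quot I)" for X
    using that assms(3) by (auto simp: carr a_r_coset_def')
  have img: "(`) h ` carrier (R Quot I) = carrier (S Quot (h ` I))"
    unfolding carr onto[symmetric] image_image by (rule image_cong[OF refl coset])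
  have "inj_on ((`) h) (carrier (R Quot I))"
    using sub inj_on_image_eq_iff[OF inj] by (auto intro!: inj_onI)
  then have bij: "bij_betw ((`) h) (carrier (R Quot I)) (carrier (S Quot (h ` I)))"
    using img by (simp add: bij_betw_def)
  show ?thesis
  proof (rule ring_iso_memI)
    show "h ` X \<in> carrier (S Quot (h ` I))" if "X \<in> carrier (R Quot I)" for X
      using img that by blast
    show "h ` (X \<otimes>\<^bsub>R Quot I\<^esub> Y) = h ` X \<otimes>\<^bsub>S Quot (h ` I)\<^esub> h ` Y"
      if "X \<in> carrier (R Quot I)" "Y \<in> carrier (R Quot I)" for X Y
    proof -
      have "h ` (I +>\<^bsub>R\<^esub> (a \<otimes>\<^bsub>R\<^esub> b)) = h ` I +>\<^bsub>S\<^esub> (h a \<otimes>\<^bsub>S\<^esub> h b)" if "a \<in> X" "b \<in> Y" for a b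
        using coset mult sub[OF \<open>X \<in> _\<close>] sub[OF \<open>Y \<in> _\<close>] that by (metis m_closed subsetD)
      then show ?thesis by (simp add: FactRing_def rcoset_mult_def image_UN)
    qed
    show "h ` (X \<oplus>\<^bsub>R Quot I\<^esub> Y) = h ` X \<oplus>\<^bsub>S Quot (h ` I)\<^esub> h ` Y"
      if "X \<in> carrier (R Quot I)" "Y \<in> carrier (R Quot I)" for X Y
    proof -
      have "h (a \<oplus>\<^bsub>R\<^esub> b) = h a \<oplus>\<^bsub>S\<^esub> h b" if "a \<in> X" "b \<in> Y" for a b
        using add sub[OF \<open>X \<in> _\<close>] sub[OF \<open>Y \<in> _\<close>] that by blast
      then show ?thesis by (simp add: FactRing_def set_add_def set_mult_def image_UN)
    qed
    show "h ` \<one>\<^bsub>R Quot I\<^esub> = \<one>\<^bsub>S Quot (h ` I)\<^esub>"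
      using coset[OF one_closed] one by (simp add: FactRing_def)
  qed (rule bij)
qed

section \<open>Endomorphism rings of isomorphic representations\<close>

lemma equivariant_linear_scaleR:
  assumes "is_rep U A"
  shows "equivariant_linear U A U A (\<lambda>x. k *\<^sub>R x)"
  using is_repD(1,3)[OF assms]
  by (intro equivariant_linearI) (auto simp: lin_on_def subspace_scale scaleR_add_right)

lemma ring_End_ring:
  assumes "is_rep U A"
  shows "ring (End_ring U A)"
proof -
  note UD = is_repD[OF assms] and U0 = subspace_0[OF is_repD(1)[OF assms]]
  let ?E = "End_ring U A"
  have mem: "f \<in> carrier ?E \<longleftrightarrow> f \<in> extensional U \<and> equivariant_linear U A U A f" for f
    by (simp add: End_ring_def)
  have ops: "f \<otimes>\<^bsub>?E\<^esub> g = (\<lambda>u\<in>U. f (g u))" "f \<oplus>\<^bsub>?E\<^esub> g = (\<lambda>u\<in>U. f u + g u)"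
    "\<one>\<^bsub>?E\<^esub> = (\<lambda>u\<in>U. u)" "\<zero>\<^bsub>?E\<^esub> = (\<lambda>u\<in>U. 0)" for f g
    by (simp_all add: End_ring_def compose_def)
  have restr: "restrict f U \<in> carrier ?E" if "equivariant_linear U A U A f" for f
    using equivariant_linear_cong[OF that assms, of "restrict f U"] by (simp add: mem)
  have E: "f u \<in> U" "f (u + v) = f u + f v" if "f \<in> carrier ?E" "u \<in> U" "v \<in> U" for f u v
    using that by (auto simp: mem intro: equivariant_linearD)
  \<comment> \<open>Carrier elements are extensional, so every ring law becomes an identity between
    values on \<open>U\<close>.\<close>
  have eqI: "f = g" if "f \<in> carrier ?E" "g \<in> carrier ?E" "\<And>u. u \<in> U \<Longrightarrow> f u = g u" for f g
    using that by (auto simp: mem intro: extensionalityI)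
  have mult: "f \<otimes>\<^bsub>?E\<^esub> g \<in> carrier ?E" and add: "f \<oplus>\<^bsub>?E\<^esub> g \<in> carrier ?E"
    if "f \<in> carrier ?E" "g \<in> carrier ?E" for f g
    using that equivariant_linear_compose[of U A U A g U A f] equivariant_linear_add[of U A U A f g]
    by (auto simp only: ops mem[of f] mem[of g] assms intro!: restr)
  have one: "\<one>\<^bsub>?E\<^esub> \<in> carrier ?E" and zero: "\<zero>\<^bsub>?E\<^esub> \<in> carrier ?E"
    unfolding ops by (rule restr equivariant_linear_ident equivariant_linear_zero[OF assms])+
  have minus: "\<exists>g\<in>carrier ?E. g \<oplus>\<^bsub>?E\<^esub> f = \<zero>\<^bsub>?E\<^esub>" if f: "f \<in> carrier ?E" for f
  proof
    show "restrict (\<lambda>u. (-1) *\<^sub>R f u) U \<in> carrier ?E" (is "?g \<in> _")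
      using f by (intro restr equivariant_linear_compose[OF _ equivariant_linear_scaleR[OF assms]])
        (simp add: mem)
    then show "?g \<oplus>\<^bsub>?E\<^esub> f = \<zero>\<^bsub>?E\<^esub>"
      by (intro eqI add zero f) (simp_all add: ops)
  qed
  show ?thesis
  proof (rule ringI)
    show "abelian_group ?E"
    proof (rule abelian_groupI)
      fix f g h assume *: "f \<in> carrier ?E" "g \<in> carrier ?E" "h \<in> carrier ?E"
      show "f \<oplus>\<^bsub>?E\<^esub> g \<oplus>\<^bsub>?E\<^esub> h = f \<oplus>\<^bsub>?E\<^esub> (g \<oplus>\<^bsub>?E\<^esub> h)"
        using * by (intro eqI add) (simp_all add: ops add.assoc)
    next
      fix f g assume *: "f \<in> carrier ?E" "g \<in> carrier ?E"
      show "f \<oplus>\<^bsub>?E\<^esub> g = g \<oplus>\<^bsub>?E\<^esub> f"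
        using * by (intro eqI add) (simp_all add: ops add.commute)
    next
      fix f assume *: "f \<in> carrier ?E"
      show "\<zero>\<^bsub>?E\<^esub> \<oplus>\<^bsub>?E\<^esub> f = f"
        using * by (intro eqI add zero) (simp_all add: ops)
    qed (fact add zero minus)+
    show "Group.monoid ?E"
    proof (rule monoidI)
      fix f g h assume *: "f \<in> carrier ?E" "g \<in> carrier ?E" "h \<in> carrier ?E"
      show "f \<otimes>\<^bsub>?E\<^esub> g \<otimes>\<^bsub>?E\<^esub> h = f \<otimes>\<^bsub>?E\<^esub> (g \<otimes>\<^bsub>?E\<^esub> h)"
        using * by (intro eqI mult) (simp_all add: ops E(1))
    next
      fix f assume *: "f \<in> carrier ?E"
      show "\<one>\<^bsub>?E\<^esub> \<otimes>\<^bsub>?E\<^esub> f = f" "f \<otimes>\<^bsub>?E\<^esub> \<one>\<^bsub>?E\<^esub> = f"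
        using * by (intro eqI mult one; simp add: ops E(1))+
    qed (fact mult one)+
    fix f g h assume *: "f \<in> carrier ?E" "g \<in> carrier ?E" "h \<in> carrier ?E"
    show "(f \<oplus>\<^bsub>?E\<^esub> g) \<otimes>\<^bsub>?E\<^esub> h = f \<otimes>\<^bsub>?E\<^esub> h \<oplus>\<^bsub>?E\<^esub> g \<otimes>\<^bsub>?E\<^esub> h"
      using * by (intro eqI mult add) (simp_all add: ops E(1))
    show "h \<otimes>\<^bsub>?E\<^esub> (f \<oplus>\<^bsub>?E\<^esub> g) = h \<otimes>\<^bsub>?E\<^esub> f \<oplus>\<^bsub>?E\<^esub> h \<otimes>\<^bsub>?E\<^esub> g"
      using * by (intro eqI mult add) (simp_all add: ops E)
  qed
qed

text \<open>The conjugation runs from \<open>W\<close> to \<open>U\<close>, the direction in which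
  it can be followed by a given isomorphism from the quotient of the endomorphism ring of
  \<open>U\<close>.\<close>

lemma End_ring_conjugation:
  assumes "is_rep U A" "is_rep W B"
    and \<phi>: "equivariant_linear U A W B \<phi>" and \<psi>: "equivariant_linear W B U A \<psi>"
    and inv: "\<forall>u\<in>U. \<psi> (\<phi> u) = u" "\<forall>w\<in>W. \<phi> (\<psi> w) = w"
  shows "(\<lambda>f. \<lambda>u\<in>U. \<psi> (f (\<phi> u))) \<in> ring_iso (End_ring W B) (End_ring U A)" (is "?c \<in> _")
proof -
  have cU: "?c f \<in> carrier (End_ring U A)" if "f \<in> carrier (End_ring W B)" for f
  proof -
    have "equivariant_linear U A U A (\<lambda>u. \<psi> (f (\<phi> u)))"
      using that equivariant_linear_compose[OF equivariant_linear_compose[OF \<phi>] \<psi>]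
      by (simp add: End_ring_def)
    then show ?thesis using equivariant_linear_cong[OF _ assms(1), where g = "?c f"]
      by (simp add: End_ring_def)
  qed
  have cW: "(\<lambda>w\<in>W. \<phi> (f (\<psi> w))) \<in> carrier (End_ring W B)" if "f \<in> carrier (End_ring U A)" for f
  proof -
    have "equivariant_linear W B W B (\<lambda>w. \<phi> (f (\<psi> w)))"
      using that equivariant_linear_compose[OF equivariant_linear_compose[OF \<psi>] \<phi>]
      by (simp add: End_ring_def)
    then show ?thesis using equivariant_linear_cong[OF _ assms(2), where g = "\<lambda>w\<in>W. \<phi> (f (\<psi> w))"]
      by (simp add: End_ring_def)
  qed
  note D = equivariant_linearD(1)[OF \<phi>] equivariant_linearD(1)[OF \<psi>]
  have EW: "f w \<in> W" if "f \<in> carrier (End_ring W B)" "w \<in> W" for f w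
    using that equivariant_linearD(1) by (auto simp: End_ring_def)
  have EU: "f u \<in> U" if "f \<in> carrier (End_ring U A)" "u \<in> U" for f u
    using that equivariant_linearD(1) by (auto simp: End_ring_def)
  have "bij_betw ?c (carrier (End_ring W B)) (carrier (End_ring U A))"
  proof (rule bij_betwI[where g = "\<lambda>f. \<lambda>w\<in>W. \<phi> (f (\<psi> w))"])
    show "(\<lambda>w\<in>W. \<phi> (?c f (\<psi> w))) = f" if "f \<in> carrier (End_ring W B)" for f
      using that D inv EW[OF that]
      by (intro extensionalityI[where A = W]) (auto simp: End_ring_def)
    show "?c (\<lambda>w\<in>W. \<phi> (f (\<psi> w))) = f" if "f \<in> carrier (End_ring U A)" for f
      using that D inv EU[OF that]
      by (intro extensionalityI[where A = U]) (auto simp: End_ring_def)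
  qed (use cU cW in auto)
  moreover have "?c (f \<otimes>\<^bsub>End_ring W B\<^esub> g) = ?c f \<otimes>\<^bsub>End_ring U A\<^esub> ?c g"
    if "f \<in> carrier (End_ring W B)" "g \<in> carrier (End_ring W B)" for f g
    using D inv(2) EW[OF that(2)]
    by (intro extensionalityI[where A = U]) (auto simp: End_ring_def compose_def)
  moreover have "?c (f \<oplus>\<^bsub>End_ring W B\<^esub> g) = ?c f \<oplus>\<^bsub>End_ring U A\<^esub> ?c g"
    if "f \<in> carrier (End_ring W B)" "g \<in> carrier (End_ring W B)" for f g
    using D EW[OF that(1)] EW[OF that(2)]
    by (intro extensionalityI[where A = U]) (auto simp: End_ring_def equivariant_linearD(2)[OF \<psi>])
  moreover have "?c \<one>\<^bsub>End_ring W B\<^esub> = \<one>\<^bsub>End_ring U A\<^esub>"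
    using D inv(1) by (intro extensionalityI[where A = U]) (auto simp: End_ring_def)
  ultimately show ?thesis using cU by (intro ring_iso_memI) auto
qed

text \<open>Conjugation matches the radicals and their cosets. It also takes scalar multiplication
  on \<open>W\<close> to scalar multiplication on \<open>U\<close> by the same number, which
  preserves the compatibility with the real scalars.\<close>

lemma End_mod_radical_iso_rep_iso:
  assumes "rep_iso U A W B" "is_rep U A" "End_mod_radical_iso U A K"
  shows "End_mod_radical_iso W B K"
proof -
  obtain \<phi> \<psi> where iso: "rep_isomorphism U A W B \<phi>"
    and \<phi>: "equivariant_linear U A W B \<phi>" and \<psi>: "equivariant_linear W B U A \<psi>"
    and inv: "\<forall>u\<in>U. \<psi> (\<phi> u) = u" "\<forall>w\<in>W. \<phi> (\<psi> w) = w"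
    using rep_isoE[OF assms(1,2)] by metis
  have W: "is_rep W B" using is_rep_isomorphic[OF iso assms(2)] .
  let ?EU = "End_ring U A" and ?EW = "End_ring W B"
  let ?JU = "jacobson_radical ?EU" and ?JW = "jacobson_radical ?EW"
  let ?c = "\<lambda>f. \<lambda>u\<in>U. \<psi> (f (\<phi> u))"
  have c: "?c \<in> ring_iso ?EW ?EU" using End_ring_conjugation[OF assms(2) W \<phi> \<psi> inv] .
  have rW: "ring ?EW" and rU: "ring ?EU" using ring_End_ring W assms(2) by auto
  have J: "?c ` ?JW = ?JU" using jacobson_radical_image[OF rW rU c] .
  obtain h where h: "h \<in> ring_iso (?EU Quot ?JU) K"
    and scalars: "\<And>k::real. h (?JU +>\<^bsub>?EU\<^esub> (\<lambda>u\<in>U. k *\<^sub>R u)) = k *\<^sub>R \<one>\<^bsub>K\<^esub>"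
    using assms(3) by (auto simp: End_mod_radical_iso_def Let_def)
  have "(`) ?c \<in> ring_iso (?EW Quot ?JW) (?EU Quot ?JU)"
    using ring_iso_image_quotient[OF rW c jacobson_radical_subset] unfolding J .
  then have "h \<circ> (`) ?c \<in> ring_iso (?EW Quot ?JW) K"
    using h by (rule ring_iso_set_trans)
  moreover have "(h \<circ> (`) ?c) (?JW +>\<^bsub>?EW\<^esub> (\<lambda>w\<in>W. k *\<^sub>R w)) = k *\<^sub>R \<one>\<^bsub>K\<^esub>" for k :: real
  proof -
    have "(\<lambda>w\<in>W. k *\<^sub>R w) \<in> carrier ?EW"
      using equivariant_linear_cong[OF equivariant_linear_scaleR[OF W, of k] W, of "\<lambda>w\<in>W. k *\<^sub>R w"] by (simp add: End_ring_def)
    then have "?c ` (?JW +>\<^bsub>?EW\<^esub> (\<lambda>w\<in>W. k *\<^sub>R w)) = ?JU +>\<^bsub>?EU\<^esub> ?c (\<lambda>w\<in>W. k *\<^sub>R w)"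
      using ring_iso_image_coset[OF rW c jacobson_radical_subset] unfolding J by blast
    moreover have "?c (\<lambda>w\<in>W. k *\<^sub>R w) = (\<lambda>u\<in>U. k *\<^sub>R u)"
      using equivariant_linearD(1,3)[OF \<phi>] equivariant_linearD(3)[OF \<psi>] inv(1)
      by (intro restrict_ext) simp
    ultimately show ?thesis using scalars by simp
  qed
  ultimately show ?thesis unfolding End_mod_radical_iso_def Let_def by blast
qed

lemma has_type_rep_iso:
  assumes "rep_iso U A W B" "is_rep U A" "has_type U A t"
  shows "has_type W B t"
  using assms(3) by (cases t) (auto intro: End_mod_radical_iso_rep_iso[OF assms(1,2)])

text \<open>The inverse isomorphism \<open>\<psi>\<close> turns a splitting of \<open>W\<close> into
  a splitting of \<open>U\<close>, and a subspace of \<open>W\<close> with zero image under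
  \<open>\<psi>\<close> is zero.\<close>

lemma indecomposable_rep_iso:
  assumes "rep_iso U A W B" "indecomposable U A"
  shows "indecomposable W B"
proof -
  have U: "is_rep U A" "U \<noteq> {0}"
    and ind: "\<And>X Y. is_rep X A \<Longrightarrow> is_rep Y A \<Longrightarrow> X \<inter> Y = {0} \<Longrightarrow>
      {x + y | x y. x \<in> X \<and> y \<in> Y} = U \<Longrightarrow> X = {0} \<or> Y = {0}"
    using assms(2) by (auto simp: indecomposable_def)
  obtain \<phi> \<psi> where iso: "rep_isomorphism U A W B \<phi>"
    and \<phi>: "equivariant_linear U A W B \<phi>" and \<psi>: "equivariant_linear W B U A \<psi>"
    and inv: "\<forall>u\<in>U. \<psi> (\<phi> u) = u" "\<forall>w\<in>W. \<phi> (\<psi> w) = w"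
    using rep_isoE[OF assms(1) U(1)] by metis
  have W: "is_rep W B" using is_rep_isomorphic[OF iso U(1)] .
  note \<phi>D = equivariant_linearD[OF \<phi>] and \<psi>D = equivariant_linearD[OF \<psi>]
  have \<phi>0: "\<phi> 0 = 0" using lin_on_zero[OF \<phi>D(5) is_repD(1)[OF U(1)]] .
  have \<psi>0: "\<psi> 0 = 0" using lin_on_zero[OF \<psi>D(5) is_repD(1)[OF W]] .
  have "W \<noteq> {0}"
  proof
    assume "W = {0}"
    then have "u = 0" if "u \<in> U" for u using \<phi>D(1)[OF that] inv(1) \<psi>0 that by (metis singletonD)
    then show False using U(2) subspace_0[OF is_repD(1)[OF U(1)]] by blast
  qed
  moreover have "X = {0} \<or> Y = {0}"
    if X: "is_rep X B" and Y: "is_rep Y B" and cap: "X \<inter> Y = {0}"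
      and sum: "{x + y | x y. x \<in> X \<and> y \<in> Y} = W" for X Y
  proof -
    have 0: "0 \<in> X" "0 \<in> Y" using subspace_0 is_repD(1)[OF X] is_repD(1)[OF Y] by auto
    have sub: "X \<subseteq> W" "Y \<subseteq> W" using 0 unfolding sum[symmetric] by force+
    have pull_zero: "Z = {0}" if "\<psi> ` Z = {0}" "Z \<subseteq> W" for Z
    proof -
      have "\<phi> ` \<psi> ` Z = Z" using inv(2) that(2) by (force simp: image_image)
      then show ?thesis using that(1) \<phi>0 by simp
    qed
    have "\<psi> ` X \<inter> \<psi> ` Y = {0}"
    proof -
      have "\<psi> x = 0" if "x \<in> X" "y \<in> Y" "\<psi> x = \<psi> y" for x y
      proof -
        have "x = y" using inv(2) sub that by (metis subsetD)
        then have "x \<in> X \<inter> Y" using that by simp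
        then show ?thesis using cap \<psi>0 by simp
      qed
      moreover have "0 \<in> \<psi> ` X" "0 \<in> \<psi> ` Y" using 0 \<psi>0 by (metis imageI)+
      ultimately show ?thesis by blast
    qed
    moreover have "{x + y | x y. x \<in> \<psi> ` X \<and> y \<in> \<psi> ` Y} = U"
    proof (intro equalityI subsetI)
      fix u assume "u \<in> U"
      then have "\<phi> u \<in> W" "\<psi> (\<phi> u) = u" using \<phi>D(1) inv(1) by auto
      then obtain x y where "x \<in> X" "y \<in> Y" "\<phi> u = x + y" using sum by blast
      then have "u = \<psi> x + \<psi> y" using \<open>\<psi> (\<phi> u) = u\<close> \<psi>D(2) sub by (metis subsetD)
      then show "u \<in> {x + y | x y. x \<in> \<psi> ` X \<and> y \<in> \<psi> ` Y}"
        using \<open>x \<in> X\<close> \<open>y \<in> Y\<close> by blast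
    next
      fix u assume "u \<in> {x + y | x y. x \<in> \<psi> ` X \<and> y \<in> \<psi> ` Y}"
      then show "u \<in> U"
        using sub \<psi>D(1) subspace_add[OF is_repD(1)[OF U(1)]] by blast
    qed
    ultimately have "\<psi> ` X = {0} \<or> \<psi> ` Y = {0}"
      by (intro ind is_rep_image[OF X equivariant_linear_mono[OF \<psi> sub(1) order_refl] U(1)]
          is_rep_image[OF Y equivariant_linear_mono[OF \<psi> sub(2) order_refl] U(1)])
    then show ?thesis using pull_zero sub by blast
  qed
  ultimately show ?thesis using W unfolding indecomposable_def by blast
qed

subsection \<open>Smooth maps on subspaces and reduced problems\<close>

text \<open>Within a proper subspace the derivative is not unique as a map of the ambient space.
  Along the line through \<open>x\<close> in a direction \<open>v\<close> of \<open>S\<close> it is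
  an ordinary derivative of a curve and therefore determined.\<close>

lemma has_derivative_unique_on_subspace:
  fixes f :: "'a::real_normed_vector \<Rightarrow> 'b::real_normed_vector"
  assumes "(f has_derivative D) (at x within S)" "(f has_derivative D') (at x within S)"
    and S: "subspace S" "x \<in> S" "v \<in> S"
  shows "D v = D' v"
proof -
  let ?g = "\<lambda>t::real. x + t *\<^sub>R v"
  have g: "(?g has_derivative (\<lambda>t. t *\<^sub>R v)) (at 0)"
    by (auto intro!: derivative_eq_intros)
  have "?g ` UNIV \<subseteq> S" using S by (auto intro: subspace_add subspace_scale)
  then have "(f has_derivative E) (at (?g 0) within (?g ` UNIV))"
    if "(f has_derivative E) (at x within S)" for E
    using has_derivative_subset[OF that] by simp
  then have "((\<lambda>t. f (?g t)) has_derivative (\<lambda>t. E (t *\<^sub>R v))) (at 0)"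
    if "(f has_derivative E) (at x within S)" for E
    using has_derivative_in_compose[OF g, of f E] that by blast
  from has_derivative_unique[OF this[OF assms(1)] this[OF assms(2)]]
  have "D (1 *\<^sub>R v) = D' (1 *\<^sub>R v)" by metis
  then show ?thesis by simp
qed

lemma frechet_derivative_on_subspace:
  fixes f :: "'a::real_normed_vector \<Rightarrow> 'b::real_normed_vector"
  assumes "(f has_derivative D) (at x within S)" "subspace S" "x \<in> S" "v \<in> S"
  shows "frechet_derivative f (at x within S) v = D v"
  using has_derivative_unique_on_subspace[OF _ assms] assms(1) frechet_derivative_works
  unfolding differentiable_def by blast

text \<open>The two functions have the same set of derivatives within \<open>S\<close>, so
  \<open>frechet_derivative\<close>, being a choice from that set, returns the same map, even in
  directions outside \<open>S\<close>.\<close>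

lemma frechet_derivative_cong:
  assumes "\<And>y. y \<in> S \<Longrightarrow> f y = g y" "x \<in> S"
  shows "frechet_derivative f (at x within S) = frechet_derivative g (at x within S)"
proof -
  have "(f has_derivative D) (at x within S) \<longleftrightarrow> (g has_derivative D) (at x within S)" for D
    using assms by (auto elim!: has_derivative_transform[rotated 2])
  then show ?thesis by (simp add: frechet_derivative_def)
qed

lemma Ck_on_cong:
  assumes "\<And>x. x \<in> S \<Longrightarrow> f x = g x" "Ck_on k S f"
  shows "Ck_on k S g"
  using assms
proof (induction k arbitrary: f g)
  case 0
  then show ?case using continuous_on_cong[of S S f g] by simp
next
  case (Suc k)
  have "g differentiable_on S"
    unfolding differentiable_on_def
  proof
    fix x assume x: "x \<in> S"
    then obtain D where "(f has_derivative D) (at x within S)"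
      using Suc.prems(2) by (auto simp: differentiable_on_def differentiable_def)
    then have "(g has_derivative D) (at x within S)"
      using x Suc.prems(1) by (auto elim!: has_derivative_transform[rotated 2])
    then show "g differentiable at x within S" by (auto simp: differentiable_def)
  qed
  moreover have "Ck_on k S (\<lambda>x. frechet_derivative g (at x within S) v)" if "v \<in> S" for v
  proof (rule Suc.IH)
    show "Ck_on k S (\<lambda>x. frechet_derivative f (at x within S) v)" using Suc.prems(2) that by simp
    show "frechet_derivative f (at x within S) v = frechet_derivative g (at x within S) v"
      if "x \<in> S" for x using frechet_derivative_cong[OF Suc.prems(1) that] by simp
  qed
  ultimately show ?case by simp
qed

text \<open>This replaces the chosen derivative by an explicit one. The two agree in the directions
  of \<open>S\<close>, the only ones over which \<open>Ck_on\<close> quantifies.\<close>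

lemma Ck_on_SucI:
  assumes "\<And>x. x \<in> S \<Longrightarrow> (f has_derivative D x) (at x within S)"
    and "subspace S" "\<And>v. v \<in> S \<Longrightarrow> Ck_on k S (\<lambda>x. D x v)"
  shows "Ck_on (Suc k) S f"
proof -
  have "f differentiable_on S"
    using assms(1) by (auto simp: differentiable_on_def differentiable_def)
  moreover have "Ck_on k S (\<lambda>x. frechet_derivative f (at x within S) v)" if "v \<in> S" for v
    using assms(3)[OF that]
    by (rule Ck_on_cong[rotated]) (rule frechet_derivative_on_subspace[symmetric, OF assms(1,2) _ that])
  ultimately show ?thesis by simp
qed

lemma Ck_on_SucD:
  assumes "Ck_on (Suc k) S f"
  shows "x \<in> S \<Longrightarrow> (f has_derivative frechet_derivative f (at x within S)) (at x within S)"
    and "v \<in> S \<Longrightarrow> Ck_on k S (\<lambda>x. frechet_derivative f (at x within S) v)"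
  using assms by (auto simp: differentiable_on_def frechet_derivative_works)

lemma Ck_on_const:
  assumes "subspace S"
  shows "Ck_on k S (\<lambda>x. c)"
proof (induction k arbitrary: c)
  case (Suc k)
  show ?case by (rule Ck_on_SucI[where D = "\<lambda>x h. 0"]) (use assms Suc in auto)
qed simp

lemma Ck_on_linear:
  fixes f :: "'a::euclidean_space \<Rightarrow> 'b::euclidean_space"
  assumes "linear f" "subspace S"
  shows "Ck_on k S f"
proof (cases k)
  case 0
  then show ?thesis using assms(1) by (simp add: linear_continuous_on linear_conv_bounded_linear)
next
  case (Suc n)
  have "Ck_on (Suc n) S f"
    by (rule Ck_on_SucI[where D = "\<lambda>x. f"])
      (use assms in \<open>auto intro: linear_imp_has_derivative Ck_on_const\<close>)
  then show ?thesis using Suc by simp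
qed

lemma Ck_on_add:
  assumes "Ck_on k S f" "Ck_on k S g" "subspace S"
  shows "Ck_on k S (\<lambda>x. f x + g x)"
  using assms(1,2)
proof (induction k arbitrary: f g)
  case 0
  then show ?case by (simp add: continuous_on_add)
next
  case (Suc k)
  show ?case
    by (rule Ck_on_SucI[OF has_derivative_add[OF Ck_on_SucD(1) Ck_on_SucD(1)] assms(3) Suc.IH])
      (use Suc.prems Ck_on_SucD(2) in \<open>auto simp del: Ck_on.simps\<close>)
qed

lemma linear_has_derivative_compose:
  fixes h :: "'b::euclidean_space \<Rightarrow> 'd::real_normed_vector"
  assumes "linear h" "(f has_derivative D) F"
  shows "((\<lambda>x. h (f x)) has_derivative (\<lambda>v. h (D v))) F"
  using bounded_linear.has_derivative[of h f D F] assms by (simp add: linear_conv_bounded_linear)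

text \<open>With linear maps on both sides, the derivative in direction \<open>v\<close> again has
  the form \<open>h (F (g x))\<close>, where \<open>F\<close> is the derivative of \<open>f\<close>
  in the fixed direction \<open>g v\<close>. The induction therefore closes without any product
  terms.\<close>

lemma Ck_on_linear_compose:
  fixes f :: "'a::euclidean_space \<Rightarrow> 'b::euclidean_space"
    and g :: "'c::euclidean_space \<Rightarrow> 'a" and h :: "'b \<Rightarrow> 'd::euclidean_space"
  assumes "Ck_on k S f" and g: "linear g" "g ` T \<subseteq> S" and h: "linear h"
    and T: "subspace T"
  shows "Ck_on k T (\<lambda>x. h (f (g x)))"
  using assms(1)
proof (induction k arbitrary: f)
  case 0
  have cont: "continuous_on T g" "continuous_on UNIV h"
    using g(1) h by (simp_all add: linear_continuous_on linear_conv_bounded_linear)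
  have "continuous_on S f" using 0 by simp
  then have "continuous_on T (\<lambda>x. f (g x))" using cont(1) g(2) by (rule continuous_on_compose2)
  with cont(2) have "continuous_on T (\<lambda>x. h (f (g x)))" by (rule continuous_on_compose2) simp
  then show ?case by simp
next
  case (Suc k)
  let ?D = "\<lambda>x. frechet_derivative f (at x within S)"
  have "((\<lambda>x. h (f (g x))) has_derivative (\<lambda>v. h (?D (g x) (g v)))) (at x within T)" if "x \<in> T" for x
  proof -
    have "(g has_derivative g) (at x within T)" using g(1) by (rule linear_imp_has_derivative)
    moreover have "(f has_derivative ?D (g x)) (at (g x) within (g ` T))"
      by (rule has_derivative_subset[OF Ck_on_SucD(1)[OF Suc.prems] g(2)]) (use g(2) that in blast)
    ultimately have "((\<lambda>x. f (g x)) has_derivative (\<lambda>v. ?D (g x) (g v))) (at x within T)"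
      by (rule has_derivative_in_compose)
    then show ?thesis by (rule linear_has_derivative_compose[OF h])
  qed
  then show ?case
  proof (rule Ck_on_SucI[OF _ T])
    fix v assume "v \<in> T"
    then have "g v \<in> S" using g(2) by blast
    then show "Ck_on k T (\<lambda>x. h (?D (g x) (g v)))"
      using Suc.IH[OF Ck_on_SucD(2)[OF Suc.prems]] by blast
  qed
qed

section \<open>Conjugation of reduced bifurcation problems\<close>

lemma conjugate_family_reduced_problems:
  fixes U :: "'u::euclidean_space set" and W :: "'w::euclidean_space set"
    and r :: "'u \<times> (real^'l) \<Rightarrow> 'u"
  assumes iso: "rep_isomorphism U A W B \<phi>" and U: "is_rep U A" and W: "is_rep W B"
    and r: "r \<in> reduced_problems Z U A"
  shows "conjugate_family U W \<phi> r \<in> reduced_problems Z W B"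
proof -
  let ?\<psi> = "inv_into U \<phi>" and ?q = "conjugate_family U W \<phi> r"
  have bij: "bij_betw \<phi> U W" and \<phi>: "equivariant_linear U A W B \<phi>"
    using iso by (auto simp: rep_isomorphism_def)
  note \<phi>D = equivariant_linearD[OF \<phi>] and UD = is_repD[OF U] and WD = is_repD[OF W]
  obtain \<psi> where \<psi>: "equivariant_linear W B U A \<psi>"
    and inv: "\<forall>u\<in>U. \<psi> (\<phi> u) = u" "\<forall>w\<in>W. \<phi> (\<psi> w) = w"
    using rep_isomorphism_inverse[OF iso UD(1,2)] by blast
  note \<psi>D = equivariant_linearD[OF \<psi>]
  have inv_eq: "inv_into U \<phi> w = \<psi> w" if "w \<in> W" for w
    using that inv \<psi>D(1) bij by (metis bij_betw_inv_into_left)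
  \<comment> \<open>Global linear extensions of \<open>\<phi>\<close> and of its inverse: on
    \<open>U\<close> and \<open>W\<close> they give the same conjugated family, and the smoothness
    and derivative rules apply to them.\<close>
  obtain h where h: "linear h" "\<And>u. u \<in> U \<Longrightarrow> h u = \<phi> u"
    using lin_on_extend[OF \<phi>D(5) UD(1)] by blast
  obtain g where g: "linear g" "\<And>w. w \<in> W \<Longrightarrow> g w = \<psi> w"
    using lin_on_extend[OF \<psi>D(5) WD(1)] by blast
  have rU: "r (u, p) \<in> U" if "u \<in> U" for u p
    using r that by (auto simp: reduced_problems_def PiE_iff)
  have smooth: "smooth_on_subspace (U \<times> UNIV) r" and r0: "r (0, 0) = 0"
    and eq: "\<And>\<sigma> u p. u \<in> U \<Longrightarrow> r (A \<sigma> u, p) = A \<sigma> (r (u, p))"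
    and spec: "\<And>\<mu>. eigenvalue_on U (frechet_derivative (\<lambda>u. r (u, 0)) (at 0 within U)) \<mu> \<Longrightarrow> \<mu> \<in> Z"
    using r by (auto simp: reduced_problems_def)
  have q: "?q (w, p) = \<phi> (r (\<psi> w, p))" if "w \<in> W" for w p
    using that by (simp add: conjugate_family_def inv_eq)
  have q': "?q (w, p) = h (r (g w, p))" if "w \<in> W" for w p
    using that q rU \<psi>D(1) g(2) h(2) by simp
  have gW: "g w \<in> U" if "w \<in> W" for w using that g(2) \<psi>D(1) by simp
  have 0: "0 \<in> U" "0 \<in> W" using UD(1) WD(1) subspace_0 by auto
  have \<phi>0: "\<phi> 0 = 0" and \<psi>0: "\<psi> 0 = 0"
    using lin_on_zero[OF \<phi>D(5) UD(1)] lin_on_zero[OF \<psi>D(5) WD(1)] .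
  have "?q \<in> W \<times> UNIV \<rightarrow>\<^sub>E W"
    using q rU \<phi>D(1) \<psi>D(1) by (auto simp: PiE_iff) (auto simp: conjugate_family_def)
  moreover have "smooth_on_subspace (W \<times> UNIV) ?q"
    unfolding smooth_on_subspace_def
  proof
    fix k
    have lin: "linear (\<lambda>x::'w \<times> (real^'l). (g (fst x), snd x))"
      using g(1) by (auto intro!: linearI simp: linear_add linear_scale)
    have "Ck_on k (W \<times> UNIV) (\<lambda>x. h (r (g (fst x), snd x)))"
      using smooth gW
      by (intro Ck_on_linear_compose[OF _ lin _ h(1) subspace_Times[OF WD(1) subspace_UNIV], of k "U \<times> UNIV"])
        (auto simp: smooth_on_subspace_def)
    then show "Ck_on k (W \<times> UNIV) ?q"
      by (rule Ck_on_cong[rotated]) (auto simp: q')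
  qed
  moreover have "?q (B \<sigma> w, p) = B \<sigma> (?q (w, p))" if "w \<in> W" for \<sigma> w p
    using that q WD(2) \<psi>D(1,4) \<phi>D(4) eq rU by simp
  moreover have "?q (0, 0) = 0" using q 0 \<phi>0 \<psi>0 r0 by simp
  moreover have "\<mu> \<in> Z"
    if \<mu>: "eigenvalue_on W (frechet_derivative (\<lambda>w. ?q (w, 0)) (at 0 within W)) \<mu>" for \<mu>
  proof (rule spec)
    let ?D = "frechet_derivative (\<lambda>u. r (u, 0)) (at 0 within U)"
      and ?E = "frechet_derivative (\<lambda>w. ?q (w, 0)) (at 0 within W)"
    have "Ck_on (Suc 0) U (\<lambda>u. r (u, 0))"
      using smooth UD(1)
      by (intro Ck_on_linear_compose[of _ "U \<times> UNIV" r "\<lambda>u. (u, 0)" U "\<lambda>x. x"])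
        (auto simp: smooth_on_subspace_def intro!: linearI simp del: Ck_on.simps)
    from Ck_on_SucD(1)[OF this 0(1)]
    have D: "((\<lambda>u. r (u, 0)) has_derivative ?D) (at 0 within U)" .
    have "(g has_derivative g) (at 0 within W)" using g(1) by (rule linear_imp_has_derivative)
    moreover have "((\<lambda>u. r (u, 0)) has_derivative ?D) (at (g 0) within (g ` W))"
      by (rule has_derivative_subset[of _ _ _ U]) (use D gW linear_0[OF g(1)] in auto)
    ultimately have "((\<lambda>w. r (g w, 0)) has_derivative (\<lambda>v. ?D (g v))) (at 0 within W)"
      by (rule has_derivative_in_compose)
    then have "((\<lambda>w. h (r (g w, 0))) has_derivative (\<lambda>v. h (?D (g v)))) (at 0 within W)"
      by (rule linear_has_derivative_compose[OF h(1)])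
    then have "((\<lambda>w. ?q (w, 0)) has_derivative (\<lambda>v. h (?D (g v)))) (at 0 within W)"
      by (rule has_derivative_transform[rotated 2]) (use 0 q' in auto)
    then have E: "?E v = h (?D (g v))" if "v \<in> W" for v
      using frechet_derivative_on_subspace[OF _ WD(1) 0(2) that] by blast
    obtain z where z: "z \<in> W \<times> W" "z \<noteq> 0" "complexify ?E z = cscale \<mu> z"
      using \<mu> by (auto simp: eigenvalue_on_def)
    obtain x y where xy: "z = (x, y)" "x \<in> W" "y \<in> W" using z(1) by auto
    \<comment> \<open>\<open>g\<close> undoes \<open>h\<close> on \<open>U\<close>, where
      \<open>r\<close> takes its values. Hence \<open>g h ?D\<close> is a derivative of the same map
      as \<open>?D\<close> and agrees with it on \<open>U\<close>.\<close>
    have ghD: "g (h (?D u)) = ?D u" if "u \<in> U" for u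
    proof (rule has_derivative_unique_on_subspace[OF _ D UD(1) 0(1) that])
      have "((\<lambda>u. g (h (r (u, 0)))) has_derivative (\<lambda>v. g (h (?D v)))) (at 0 within U)"
        by (rule linear_has_derivative_compose[OF g(1) linear_has_derivative_compose[OF h(1) D]])
      then show "((\<lambda>u. r (u, 0)) has_derivative (\<lambda>v. g (h (?D v)))) (at 0 within U)"
        by (rule has_derivative_transform[rotated 2]) (use 0 g(2) h(2) inv(1) rU \<phi>D(1) in auto)
    qed
    have E_xy: "?E x = Re \<mu> *\<^sub>R x - Im \<mu> *\<^sub>R y" "?E y = Im \<mu> *\<^sub>R x + Re \<mu> *\<^sub>R y"
      using z(3) xy(1) by (simp_all add: complexify_def cscale_def)
    \<comment> \<open>The linearizations are conjugate by \<open>g\<close>, so \<open>g\<close>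
      takes an eigenvector for \<open>\<mu>\<close> on \<open>W\<close> to one on
      \<open>U\<close>.\<close>
    have "?D (g x) = g (?E x)" "?D (g y) = g (?E y)"
      using ghD[OF gW] E xy(2,3) by simp_all
    then have "complexify ?D (g x, g y) = cscale \<mu> (g x, g y)"
      using g(1) by (simp add: E_xy complexify_def cscale_def linear_add linear_diff linear_scale)
    moreover have "(g x, g y) \<noteq> 0"
    proof
      assume "(g x, g y) = 0"
      then have "x = 0" "y = 0" using g(2) xy(2,3) inv(2) \<phi>0 by (metis fst_zero snd_zero fst_conv snd_conv)+
      then show False using z(2) xy(1) by (simp add: zero_prod_def)
    qed
    ultimately show "eigenvalue_on U ?D \<mu>"
      unfolding eigenvalue_on_def using gW xy(2,3) by blast
  qed
  ultimately show ?thesis by (auto simp: reduced_problems_def)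
qed

lemma conjugate_family_inverse:
  fixes r :: "'u::euclidean_space \<times> (real^'l) \<Rightarrow> 'u" and \<phi> :: "'u \<Rightarrow> 'w::euclidean_space"
  assumes bij: "bij_betw \<phi> U W" and r: "r \<in> U \<times> UNIV \<rightarrow>\<^sub>E U"
  shows "conjugate_family W U (inv_into U \<phi>) (conjugate_family U W \<phi> r) = r"
proof (rule extensionalityI[where A = "U \<times> UNIV"])
  fix x assume "x \<in> U \<times> (UNIV :: (real^'l) set)"
  then obtain u p where x: "x = (u, p)" "u \<in> U" by auto
  have inv: "inv_into U \<phi> (\<phi> v) = v" if "v \<in> U" for v
    using bij that by (simp add: bij_betw_inv_into_left)
  have "inv_into W (inv_into U \<phi>) u = \<phi> u"
    using inv_into_inv_into_eq[OF bij x(2)] .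
  moreover have "\<phi> u \<in> W" using bij x(2) by (rule bij_betw_apply)
  moreover have "r (u, p) \<in> U" using r x(2) by auto
  ultimately show "conjugate_family W U (inv_into U \<phi>) (conjugate_family U W \<phi> r) x = r x"
    using x inv by (simp add: conjugate_family_def)
qed (use r in \<open>auto simp: conjugate_family_def PiE_iff\<close>)

lemma rep_isomorphism_inv_into:
  assumes "rep_isomorphism U A W B \<phi>" "is_rep U A"
  shows "rep_isomorphism W B U A (inv_into U \<phi>)"
proof -
  have bij: "bij_betw \<phi> U W" using assms(1) by (simp add: rep_isomorphism_def)
  obtain \<psi> where \<psi>: "equivariant_linear W B U A \<psi>" and inv: "\<forall>w\<in>W. \<phi> (\<psi> w) = w"
    using rep_isomorphism_inverse[OF assms(1) is_repD(1,2)[OF assms(2)]] by blast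
  have "inv_into U \<phi> w = \<psi> w" if "w \<in> W" for w
    using inv that equivariant_linearD(1)[OF \<psi> that] bij_betw_inv_into_left[OF bij, of "\<psi> w"] by simp
  then have "equivariant_linear W B U A (inv_into U \<phi>)"
    using equivariant_linear_cong[OF \<psi> is_rep_isomorphic[OF assms]] by blast
  then show ?thesis using bij_betw_inv_into[OF bij] by (simp add: rep_isomorphism_def)
qed

text \<open>Conjugate linearizations have the same eigenvalues, so the argument is uniform in
  \<open>Z\<close> and covers kernel and center reductions alike.\<close>

lemma equivalent_reduced_problemsI:
  fixes U :: "'u::euclidean_space set" and W :: "'w::euclidean_space set"
  assumes iso: "rep_isomorphism U A W B \<phi>" and U: "is_rep U A"
  shows "equivalent_reduced_problems TYPE(real^'l) Z U A W B"
  unfolding equivalent_reduced_problems_def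
proof (intro exI conjI)
  have W: "is_rep W B" using is_rep_isomorphic[OF iso U] .
  have bij: "bij_betw \<phi> U W" using iso by (simp add: rep_isomorphism_def)
  let ?\<psi> = "inv_into U \<phi>"
  have iso': "rep_isomorphism W B U A ?\<psi>" using rep_isomorphism_inv_into[OF iso U] .
  show "rep_isomorphism U A W B \<phi>" by (rule iso)
  show "bij_betw (conjugate_family U W \<phi>)
      (reduced_problems Z U A :: ('u \<times> (real^'l) \<Rightarrow> 'u) set) (reduced_problems Z W B)"
  proof (rule bij_betwI[where g = "conjugate_family W U ?\<psi>"])
    show "conjugate_family U W \<phi> \<in> reduced_problems Z U A \<rightarrow> reduced_problems Z W B"
      using conjugate_family_reduced_problems[OF iso U W] by blast
    show "conjugate_family W U ?\<psi> \<in> reduced_problems Z W B \<rightarrow> reduced_problems Z U A"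
      using conjugate_family_reduced_problems[OF iso' W U] by blast
    show "conjugate_family W U ?\<psi> (conjugate_family U W \<phi> r) = r"
      if "r \<in> reduced_problems Z U A" for r
      using that by (intro conjugate_family_inverse[OF bij]) (simp add: reduced_problems_def)
    show "conjugate_family U W \<phi> (conjugate_family W U ?\<psi> r) = r"
      if "r \<in> reduced_problems Z W B" for r :: "'w \<times> (real^'l) \<Rightarrow> 'w"
    proof -
      have "r \<in> W \<times> UNIV \<rightarrow>\<^sub>E W" using that by (simp add: reduced_problems_def)
      from conjugate_family_inverse[OF bij_betw_inv_into[OF bij] this]
      have "conjugate_family U W (inv_into W ?\<psi>) (conjugate_family W U ?\<psi> r) = r" .
      \<comment> \<open>Applying the inversion lemma to \<open>?\<psi>\<close> produces the double
        inverse in place of \<open>\<phi>\<close>. The two agree on \<open>U\<close> and have the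
        same inverse on \<open>W\<close>, which is all that conjugation reads.\<close>
      moreover have "conjugate_family U W (inv_into W ?\<psi>) q = conjugate_family U W \<phi> q"
        if q: "q \<in> reduced_problems Z U A" for q :: "'u \<times> (real^'l) \<Rightarrow> 'u"
      proof -
        have qU: "q (u, p) \<in> U" if "u \<in> U" for u p
          using q that by (auto simp: reduced_problems_def)
        have \<psi>W: "?\<psi> w \<in> U" "inv_into U (inv_into W ?\<psi>) w = ?\<psi> w" if "w \<in> W" for w
          using bij_betw_apply[OF bij_betw_inv_into[OF bij] that]
            inv_into_inv_into_eq[OF bij_betw_inv_into[OF bij] that] by auto
        show ?thesis
          unfolding conjugate_family_def
          by (rule restrict_ext) (auto simp: \<psi>W inv_into_inv_into_eq[OF bij qU])
      qed
      moreover have "conjugate_family W U ?\<psi> r \<in> reduced_problems Z U A"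
        using conjugate_family_reduced_problems[OF iso' W U that] .
      ultimately show ?thesis by simp
    qed
  qed
qed

subsection \<open>Networks with different internal phase spaces\<close>

definition vec_map :: "('v \<Rightarrow> 'w) \<Rightarrow> ('v, 's::finite) vec \<Rightarrow> ('w, 's) vec" where
  "vec_map h v = (\<chi> \<sigma>. h (v $ \<sigma>))"

lemma vec_map_nth [simp]: "vec_map h v $ \<sigma> = h (v $ \<sigma>)"
  by (simp add: vec_map_def)

lemma linear_vec_map:
  assumes "linear h"
  shows "linear (vec_map h)"
  using assms by (intro linearI) (simp_all add: vec_eq_iff linear_add linear_scale)

lemma net_action_nth [simp]: "net_action \<sigma> v $ \<tau> = v $ (\<tau> * \<sigma>)"
  by (simp add: net_action_def)

lemma is_rep_net_action:
  "is_rep (UNIV :: ('v::euclidean_space, 's::{finite,monoid_mult}) vec set) net_action"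
  by (auto simp: is_rep_def lin_on_def vec_eq_iff mult.assoc)

text \<open>\<open>net_action\<close> only relabels cells, whereas \<open>vec_map h\<close> does the
  same thing inside every cell; hence the two commute.\<close>

lemma equivariant_linear_vec_map:
  assumes "linear h"
  shows "equivariant_linear UNIV net_action UNIV net_action (vec_map h)"
  by (intro equivariant_linearI)
    (simp_all add: vec_eq_iff linear_add[OF assms] linear_scale[OF assms])

text \<open>This supplies the hypothesis \<open>summands\<close> of
  \<open>iso_direct_sum_add_complement\<close> for the whole larger phase space. The identity of
  \<open>Y\<close> is split first over the coordinates of the larger internal space and then over
  the summands of the smaller network.\<close>

lemma summand_iso_net_summand:
  fixes Y :: "('v2::euclidean_space, 's::{finite,monoid_mult}) vec set"
    and W :: "nat \<Rightarrow> ('v1::euclidean_space, 's) vec set"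
  assumes W: "\<forall>i<N. indecomposable (W i) net_action"
    and s: "iso_direct_sum (UNIV :: ('v1, 's) vec set) net_action N W net_action s"
    and Y: "indecomposable Y net_action"
    and \<rho>: "equivariant_linear UNIV net_action Y net_action \<rho>" "\<And>y. y \<in> Y \<Longrightarrow> \<rho> y = y"
  shows "\<exists>i<N. rep_iso (W i) net_action Y net_action"
proof -
  obtain c :: 'v1 where c: "c \<in> Basis" using nonempty_Basis by blast
  have Wr: "\<forall>i<N. is_rep (W i) net_action" using W by (simp add: indecomposable_def)
  obtain e \<pi> where D: "direct_sum_maps (UNIV :: ('v1, 's) vec set) net_action
      (copies N s) (\<lambda>p. W (fst p)) net_action e \<pi>"
    using s unfolding iso_direct_sum_iff[OF is_rep_net_action Wr] by blast
  \<comment> \<open>\<open>a b\<close> stores the coordinate along \<open>b\<close> in the direction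
    \<open>c\<close>, and \<open>a' b\<close> reads it back. As \<open>c\<close> is a unit vector,
    each round trip is the projection onto the coordinate \<open>b\<close>, and these sum to the
    identity.\<close>
  define a :: "'v2 \<Rightarrow> ('v2, 's) vec \<Rightarrow> ('v1, 's) vec" where "a b = vec_map (\<lambda>x. (x \<bullet> b) *\<^sub>R c)" for b
  define a' :: "'v2 \<Rightarrow> ('v1, 's) vec \<Rightarrow> ('v2, 's) vec" where "a' b = vec_map (\<lambda>x. (x \<bullet> c) *\<^sub>R b)" for b
  have a: "equivariant_linear UNIV net_action UNIV net_action (a b)" for b
    unfolding a_def
    by (intro equivariant_linear_vec_map linearI) (simp_all add: inner_add_left scaleR_add_left)
  have a': "equivariant_linear UNIV net_action UNIV net_action (a' b)" for b
    unfolding a'_def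
    by (intro equivariant_linear_vec_map linearI) (simp_all add: inner_add_left scaleR_add_left)
  have a'a: "(\<Sum>b\<in>Basis. a' b (a b v)) = v" for v
    using c by (simp add: vec_eq_iff a_def a'_def inner_Basis euclidean_representation)
  have \<rho>': "\<rho> (\<Sum>i\<in>I. x i) = (\<Sum>i\<in>I. \<rho> (x i))" if "finite I" for I :: "'v2 set" and x
    using lin_on_sum[OF equivariant_linearD(5)[OF \<rho>(1)] subspace_UNIV that] by blast
  have \<rho>a': "\<rho> (a' b (\<Sum>p\<in>copies N s. x p)) = (\<Sum>p\<in>copies N s. \<rho> (a' b (x p)))" for b x
    using lin_on_sum[OF equivariant_linearD(5)[OF equivariant_linear_compose[OF a' \<rho>(1)]] subspace_UNIV, of "copies N s" x]
    by simp
  have "\<exists>j\<in>(Basis :: 'v2 set) \<times> copies N s. rep_iso Y net_action (W (fst (snd j))) net_action"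
  proof (rule indecomposable_factor_iso[OF Y, where V = "\<lambda>j. W (fst (snd j))"
        and \<alpha> = "\<lambda>j y. \<pi> (snd j) (a (fst j) y)" and \<beta> = "\<lambda>j w. \<rho> (a' (fst j) (e (snd j) w))"])
    show "finite ((Basis :: 'v2 set) \<times> copies N s)" by simp
    show "indecomposable (W (fst (snd j))) net_action" if "j \<in> Basis \<times> copies N s" for j :: "'v2 \<times> nat \<times> nat"
      using that W by auto
    show "equivariant_linear Y net_action (W (fst (snd j))) net_action (\<lambda>y. \<pi> (snd j) (a (fst j) y))"
      if "j \<in> Basis \<times> copies N s" for j
    proof (rule equivariant_linear_mono[OF _ subset_UNIV order_refl])
      have "snd j \<in> copies N s" using that by (simp add: mem_Times_iff)
      from equivariant_linear_compose[OF a direct_sum_mapsD(2)[OF D this]]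
      show "equivariant_linear UNIV net_action (W (fst (snd j))) net_action (\<lambda>y. \<pi> (snd j) (a (fst j) y))" .
    qed
    show "equivariant_linear (W (fst (snd j))) net_action Y net_action (\<lambda>w. \<rho> (a' (fst j) (e (snd j) w)))"
      if "j \<in> Basis \<times> copies N s" for j
    proof -
      have "snd j \<in> copies N s" using that by (simp add: mem_Times_iff)
      from equivariant_linear_compose[OF direct_sum_mapsD(1)[OF D this] equivariant_linear_compose[OF a' \<rho>(1)]]
      show ?thesis .
    qed
    fix y assume y: "y \<in> Y"
    have "(\<Sum>j\<in>Basis \<times> copies N s. \<rho> (a' (fst j) (e (snd j) (\<pi> (snd j) (a (fst j) y))))) =
        (\<Sum>b\<in>Basis. \<Sum>p\<in>copies N s. \<rho> (a' b (e p (\<pi> p (a b y)))))"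
      by (simp add: sum.cartesian_product case_prod_beta)
    also have "\<dots> = (\<Sum>b\<in>Basis. \<rho> (a' b (\<Sum>p\<in>copies N s. e p (\<pi> p (a b y)))))"
      by (simp only: \<rho>a')
    also have "\<dots> = (\<Sum>b\<in>Basis. \<rho> (a' b (a b y)))"
      by (simp only: direct_sum_mapsD(4)[OF D UNIV_I])
    also have "\<dots> = \<rho> (\<Sum>b\<in>Basis. a' b (a b y))" by (rule \<rho>'[symmetric]) simp
    finally show "(\<Sum>j\<in>Basis \<times> copies N s. \<rho> (a' (fst j) (e (snd j) (\<pi> (snd j) (a (fst j) y))))) = y"
      using a'a \<rho>(2)[OF y] by simp
  qed
  then obtain i where "i < N" "rep_iso Y net_action (W i) net_action" by auto
  moreover have "is_rep Y net_action" using Y by (simp add: indecomposable_def)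
  ultimately show ?thesis using rep_iso_sym by blast
qed

lemma vec_map_rep_isomorphism:
  fixes j :: "'v1::euclidean_space \<Rightarrow> 'v2::euclidean_space"
    and X :: "('v1, 's::{finite,monoid_mult}) vec set"
  assumes j: "linear j" and q: "linear q" and qj: "\<And>x. q (j x) = x"
  shows "rep_isomorphism X net_action (vec_map j ` X) net_action (vec_map j)"
proof -
  have "vec_map q (vec_map j v) = v" for v :: "('v1, 's) vec" by (simp add: vec_eq_iff qj)
  then have "inj_on (vec_map j) X" by (metis inj_on_inverseI)
  moreover have "equivariant_linear X net_action (vec_map j ` X) net_action (vec_map j)"
    by (intro equivariant_linearI) (auto simp: vec_eq_iff linear_add[OF j] linear_scale[OF j])
  ultimately show ?thesis by (simp add: rep_isomorphism_def bij_betw_def)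
qed

text \<open>The list of types and the multiplicities \<open>m\<close> are kept, so the cost bound
  carries over for either \<open>cost\<close>. Only \<open>s\<close> is replaced, by a larger
  \<open>s'\<close>.\<close>

lemma generic_rep_embed:
  fixes j :: "'v1::euclidean_space \<Rightarrow> 'v2::euclidean_space"
    and U :: "'u::euclidean_space set" and A :: "'s::{finite,monoid_mult} \<Rightarrow> 'u \<Rightarrow> 'u"
  assumes j: "linear j" and q: "linear q" and qj: "\<And>x. q (j x) = x"
    and U: "is_rep U A" and gen: "generic_rep TYPE('v1) cost l U A"
  shows "generic_rep TYPE('v2) cost l U A"
proof -
  obtain N and W :: "nat \<Rightarrow> ('v1, 's) vec set" and t s m where
    WT: "\<forall>i<N. indecomposable (W i) net_action \<and> has_type (W i) net_action (t i)"
    and noniso: "\<forall>i<N. \<forall>k<N. i \<noteq> k \<longrightarrow> \<not> rep_iso (W i) net_action (W k) net_action"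
    and s: "iso_direct_sum (UNIV :: ('v1, 's) vec set) net_action N W net_action s"
    and m: "iso_direct_sum U A N W net_action m"
    and ms: "\<forall>i<N. m i \<le> s i" and cost: "(\<Sum>i<N. cost (t i) (m i)) \<le> l"
    using gen unfolding generic_rep_def by (elim exE conjE) (rule that; assumption)
  have W: "\<forall>i<N. indecomposable (W i) net_action" using WT by blast
  have Wr: "\<forall>i<N. is_rep (W i) net_action" using W by (simp add: indecomposable_def)
  let ?J = "vec_map j :: ('v1, 's) vec \<Rightarrow> ('v2, 's) vec"
  let ?P = "vec_map q :: ('v2, 's) vec \<Rightarrow> ('v1, 's) vec"
  have J: "equivariant_linear UNIV net_action UNIV net_action ?J"
    and P: "equivariant_linear UNIV net_action UNIV net_action ?P"
    using equivariant_linear_vec_map j q by blast+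
  have PJ: "?P (?J v) = v" for v by (simp add: vec_eq_iff qj)
  have linJ: "linear ?J" and linP: "linear ?P" using linear_vec_map j q by blast+
  define X where "X = range ?J"
  define C where "C = {v \<in> UNIV. ?P v = 0}"
  have X: "is_rep X net_action"
    unfolding X_def by (rule is_rep_image[OF is_rep_net_action J is_rep_net_action])
  have C: "is_rep C net_action"
    unfolding C_def by (rule is_rep_kernel[OF is_rep_net_action P is_rep_net_action])
  have "?J 0 = 0" using linJ by (rule linear_0)
  then have cap: "X \<inter> C = {0}"
    using PJ linear_0[OF linP] by (auto simp: X_def C_def) 
  have JP: "v - ?J (?P v) \<in> C" for v
    using PJ by (simp add: C_def linear_diff[OF linP])
  have "v \<in> sub_sum X C" for v
  proof -
    have "v = ?J (?P v) + (v - ?J (?P v))" by simp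
    then show ?thesis using JP unfolding X_def by blast
  qed
  then have sum: "sub_sum X C = UNIV" by blast
  have "iso_direct_sum X net_action N W net_action s"
  proof (rule iso_direct_sum_rep_iso[OF s _ is_rep_net_action Wr])
    show "rep_iso (UNIV :: ('v1, 's) vec set) net_action X net_action"
      unfolding X_def rep_iso_def by (rule exI[of _ ?J]) (rule vec_map_rep_isomorphism[OF j q qj])
  qed
  \<comment> \<open>\<open>?J ?P\<close> is an equivariant idempotent with range \<open>X\<close>,
    and its complementary idempotent is the retraction onto \<open>C\<close> on which the induction
    starts.\<close>
  moreover have "equivariant_linear UNIV net_action C net_action (\<lambda>v. v - ?J (?P v))"
    using JP by (intro equivariant_linearI)
      (simp_all add: linear_add[OF linJ] linear_add[OF linP] linear_scale[OF linJ] linear_scale[OF linP]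
        scaleR_diff_right vec_eq_iff)
  moreover have "c - ?J (?P c) = c" if "c \<in> C" for c
    using that linear_0[OF linJ] by (simp add: C_def)
  ultimately have "\<exists>s'. (\<forall>i<N. s i \<le> s' i) \<and> iso_direct_sum (sub_sum X C) net_action N W net_action s'"
    using summand_iso_net_summand[OF W s]
    by (intro iso_direct_sum_add_complement[OF is_rep_net_action Wr _ _ X subset_UNIV C subset_UNIV cap]) blast+
  then obtain s' where s': "\<forall>i<N. s i \<le> s' i"
    "iso_direct_sum (UNIV :: ('v2, 's) vec set) net_action N W net_action s'"
    unfolding sum by blast
  \<comment> \<open>\<open>generic_rep\<close> requires the model summands to be subspaces of the
    larger phase space, so they are replaced by their images.\<close>
  define W' where "W' i = ?J ` W i" for i
  have iso: "rep_iso (W i) net_action (W' i) net_action" for i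
    unfolding W'_def rep_iso_def by (rule exI[of _ ?J]) (rule vec_map_rep_isomorphism[OF j q qj])
  have "\<forall>i<N. indecomposable (W' i) net_action \<and> has_type (W' i) net_action (t i)"
    using WT Wr indecomposable_rep_iso[OF iso] has_type_rep_iso[OF iso] by blast
  moreover have "\<not> rep_iso (W' i) net_action (W' k) net_action" if "i < N" "k < N" "i \<noteq> k" for i k
    using noniso that rep_iso_trans[OF iso rep_iso_trans[OF _ rep_iso_sym[OF iso]]] Wr by blast
  moreover have "iso_direct_sum (UNIV :: ('v2, 's) vec set) net_action N W' net_action s'"
    using iso_direct_sum_summands[OF s'(2) is_rep_net_action Wr] iso by blast
  moreover have "iso_direct_sum U A N W' net_action m"
    using iso_direct_sum_summands[OF m U Wr] iso by blast
  moreover have "\<forall>i<N. m i \<le> s' i" using ms s'(1) by (meson order_trans)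
  ultimately show ?thesis using cost unfolding generic_rep_def by blast
qed

subsection \<open>Linearization of the extended network\<close>

lemma net_field_has_derivative:
  fixes f :: "('v::euclidean_space, 's::{finite,monoid_mult}) vec \<times> (real^'l) \<Rightarrow> 'v"
  assumes "smooth_on_subspace UNIV f"
  shows "((\<lambda>v. net_field f v 0) has_derivative net_linearization f) (at 0)"
proof -
  \<comment> \<open>The field is the sum over the cells of \<open>emb \<sigma>\<close> after
    \<open>f\<close> after \<open>shift \<sigma>\<close>: a linear choice of inputs, the common
    response, and a linear insertion of the output. Its differentiability thus follows from that of
    \<open>f\<close>.\<close>
  define shift :: "'s \<Rightarrow> ('v, 's) vec \<Rightarrow> ('v, 's) vec \<times> (real^'l)" where
    "shift \<sigma> v = (\<chi> \<tau>. v $ (\<tau> * \<sigma>), 0)" for \<sigma> v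
  define emb :: "'s \<Rightarrow> 'v \<Rightarrow> ('v, 's) vec" where "emb \<sigma> x = (\<chi> \<tau>. if \<tau> = \<sigma> then x else 0)" for \<sigma> x
  have shift: "linear (shift \<sigma>)" for \<sigma>
    by (intro linearI) (auto simp: shift_def vec_eq_iff)
  have emb: "linear (emb \<sigma>)" for \<sigma>
    by (intro linearI) (auto simp: emb_def vec_eq_iff)
  have "Ck_on (Suc 0) UNIV f" using assms by (simp add: smooth_on_subspace_def del: Ck_on.simps)
  then have f: "(f has_derivative frechet_derivative f (at x)) (at x)" for x
    using Ck_on_SucD(1) by blast
  have "((\<lambda>v. emb \<sigma> (f (shift \<sigma> v))) has_derivative
      (\<lambda>h. emb \<sigma> (frechet_derivative f (at (shift \<sigma> 0)) (shift \<sigma> h)))) (at 0)" for \<sigma>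
    by (rule linear_has_derivative_compose[OF emb has_derivative_compose[OF linear_imp_has_derivative[OF shift] f]])
  then have "((\<lambda>v. \<Sum>\<sigma>\<in>UNIV. emb \<sigma> (f (shift \<sigma> v))) has_derivative
      (\<lambda>h. \<Sum>\<sigma>\<in>UNIV. emb \<sigma> (frechet_derivative f (at (shift \<sigma> 0)) (shift \<sigma> h)))) (at 0)"
    by (rule has_derivative_sum)
  moreover have "(\<Sum>\<sigma>\<in>UNIV. emb \<sigma> (f (shift \<sigma> v))) = net_field f v 0" for v
    by (simp add: vec_eq_iff emb_def shift_def net_field_def)
  ultimately have "(\<lambda>v. net_field f v 0) differentiable (at 0)"
    unfolding differentiable_def by auto
  then show ?thesis
    unfolding net_linearization_def frechet_derivative_works .
qed

text \<open>Every power of \<open>L2\<close> is the corresponding power of \<open>L\<close> on the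
  range of \<open>J\<close> and leaves the part \<open>v - J (P v)\<close> unchanged. A vector
  annihilated by a power therefore has no such part.\<close>

lemma generalized_kernel_extend:
  assumes J: "linear J" and P: "linear P" and PJ: "\<And>x. P (J x) = x" and L: "linear L"
    and L2: "\<And>v. L2 v = J (L (P v)) + (v - J (P v))"
  shows "generalized_kernel L2 = J ` generalized_kernel L"
proof -
  have L2n: "(L2 ^^ k) v = J ((L ^^ k) (P v)) + (v - J (P v))" for k v
    by (induction k) (simp_all add: L2 linear_add[OF P] linear_diff[OF P] PJ)
  have Ln0: "(L ^^ k) 0 = 0" for k by (induction k) (simp_all add: linear_0[OF L])
  show ?thesis
  proof (intro equalityI subsetI)
    fix v assume "v \<in> generalized_kernel L2"
    then obtain k where k: "(L2 ^^ k) v = 0" by (auto simp: generalized_kernel_def)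
    have "P ((L2 ^^ k) v) = (L ^^ k) (P v)"
      by (simp add: L2n linear_add[OF P] linear_diff[OF P] PJ)
    then have 0: "(L ^^ k) (P v) = 0" using k linear_0[OF P] by simp
    then have "v = J (P v)" using k L2n[of k v] linear_0[OF J] by simp
    then show "v \<in> J ` generalized_kernel L" using 0 by (auto simp: generalized_kernel_def)
  next
    fix v assume "v \<in> J ` generalized_kernel L"
    then obtain u k where "v = J u" "(L ^^ k) u = 0" by (auto simp: generalized_kernel_def)
    then have "(L2 ^^ k) v = 0" by (simp add: L2n PJ linear_0[OF J])
    then show "v \<in> generalized_kernel L2" by (auto simp: generalized_kernel_def)
  qed
qed

text \<open>Multiplication by the conjugate of \<open>\<mu>\<close> gives the squared modulus times
  each component.\<close>

lemma cscale_eq_0_iff: "cscale \<mu> z = 0 \<longleftrightarrow> \<mu> = 0 \<or> z = 0"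
proof
  obtain a b x y where *: "\<mu> = Complex a b" "z = (x, y)" by (metis complex.collapse surj_pair)
  assume "cscale \<mu> z = 0"
  then have 1: "a *\<^sub>R x = b *\<^sub>R y" and 2: "b *\<^sub>R x + a *\<^sub>R y = 0"
    by (auto simp: * cscale_def zero_prod_def)
  have "(a * a + b * b) *\<^sub>R x = a *\<^sub>R (a *\<^sub>R x) + b *\<^sub>R (b *\<^sub>R x)" by (simp add: scaleR_add_left)
  also have "\<dots> = b *\<^sub>R (b *\<^sub>R x + a *\<^sub>R y)" by (simp add: 1 scaleR_add_right mult.commute)
  finally have x: "(a * a + b * b) *\<^sub>R x = 0" using 2 by simp
  have "(a * a + b * b) *\<^sub>R y = a *\<^sub>R (a *\<^sub>R y) + b *\<^sub>R (b *\<^sub>R y)" by (simp add: scaleR_add_left)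
  also have "\<dots> = a *\<^sub>R (b *\<^sub>R x + a *\<^sub>R y)" by (simp add: 1[symmetric] scaleR_add_right mult.commute)
  finally have y: "(a * a + b * b) *\<^sub>R y = 0" using 2 by simp
  show "\<mu> = 0 \<or> z = 0"
    using x y by (auto simp: * complex_eq_iff zero_prod_def)
qed (auto simp: cscale_def zero_prod_def)

text \<open>\<open>JJ\<close> and \<open>PP\<close> intertwine the complexified maps and so exchange
  generalized eigenvectors. On the part seen by \<open>QQ\<close>, subtracting \<open>\<mu>\<close>
  from \<open>L2\<close> amounts to multiplication by \<open>1 - \<mu>\<close>, which is invertible
  for \<open>\<mu>\<close> on the imaginary axis. All generators of the center span thus lie in the
  kernel of \<open>QQ\<close>.\<close>

lemma center_subspace_extend:
  fixes J :: "'a::real_vector \<Rightarrow> 'b::real_vector"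
  assumes J: "linear J" and P: "linear P" and PJ: "\<And>x. P (J x) = x" and L: "linear L"
    and L2: "\<And>v. L2 v = J (L (P v)) + (v - J (P v))"
  shows "center_subspace L2 = J ` center_subspace L"
proof -
  define JJ where "JJ z = (J (fst z), J (snd z))" for z
  define PP where "PP z = (P (fst z), P (snd z))" for z
  define QQ where "QQ z = z - JJ (PP z)" for z
  have linJJ: "linear JJ" and linPP: "linear PP"
    unfolding JJ_def PP_def using J P by (auto intro!: linearI simp: linear_add linear_scale)
  have linQQ: "linear QQ"
    unfolding QQ_def by (intro linear_compose_sub linear_id[unfolded id_def] linear_compose[OF linPP linJJ, unfolded comp_def])
  let ?T1 = "\<lambda>\<mu> w. complexify L w - cscale \<mu> w" and ?T2 = "\<lambda>\<mu> w. complexify L2 w - cscale \<mu> w"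
  let ?G1 = "\<Union>\<mu>\<in>{\<mu>. Re \<mu> = 0}. gen_eigenspace L \<mu>"
  let ?G2 = "\<Union>\<mu>\<in>{\<mu>. Re \<mu> = 0}. gen_eigenspace L2 \<mu>"
  have T2J: "?T2 \<mu> (JJ z) = JJ (?T1 \<mu> z)" for \<mu> z
    by (simp add: complexify_def cscale_def JJ_def L2 PJ linear_add[OF J] linear_diff[OF J] linear_scale[OF J])
  have PT2: "PP (?T2 \<mu> z) = ?T1 \<mu> (PP z)" for \<mu> z
    by (simp add: complexify_def cscale_def PP_def L2 PJ linear_add[OF P] linear_diff[OF P] linear_scale[OF P])
  have QT2: "QQ (?T2 \<mu> z) = cscale (1 - \<mu>) (QQ z)" for \<mu> z
    by (simp add: complexify_def cscale_def QQ_def JJ_def PP_def L2 PJ linear_add[OF P] linear_diff[OF P]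
        linear_scale[OF P] linear_add[OF J] linear_diff[OF J] linear_scale[OF J] algebra_simps)
  have T2Jn: "((?T2 \<mu>) ^^ k) (JJ z) = JJ (((?T1 \<mu>) ^^ k) z)" for \<mu> k z
    by (induction k) (simp_all add: T2J)
  have PT2n: "PP (((?T2 \<mu>) ^^ k) z) = ((?T1 \<mu>) ^^ k) (PP z)" for \<mu> k z
    by (induction k) (simp_all add: PT2)
  have QT2n: "QQ (((?T2 \<mu>) ^^ k) z) = 0 \<Longrightarrow> QQ z = 0" if "\<mu> \<noteq> 1" for \<mu> k z
    using that by (induction k) (simp_all add: QT2 cscale_eq_0_iff)
  have G12: "JJ ` ?G1 \<subseteq> ?G2"
  proof
    fix w assume "w \<in> JJ ` ?G1"
    then obtain z \<mu> k where *: "w = JJ z" "Re \<mu> = 0" "((?T1 \<mu>) ^^ k) z = 0"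
      by (auto simp: gen_eigenspace_def)
    then have "((?T2 \<mu>) ^^ k) w = 0" by (simp only: T2Jn linear_0[OF linJJ])
    then have "w \<in> gen_eigenspace L2 \<mu>" unfolding gen_eigenspace_def by blast
    then show "w \<in> ?G2" using *(2) by blast
  qed
  have G21: "PP ` ?G2 \<subseteq> ?G1"
  proof
    fix w assume "w \<in> PP ` ?G2"
    then obtain z \<mu> k where *: "w = PP z" "Re \<mu> = 0" "((?T2 \<mu>) ^^ k) z = 0"
      by (auto simp: gen_eigenspace_def)
    then have "((?T1 \<mu>) ^^ k) w = 0" by (simp only: PT2n[symmetric] linear_0[OF linPP])
    then have "w \<in> gen_eigenspace L \<mu>" unfolding gen_eigenspace_def by blast
    then show "w \<in> ?G1" using *(2) by blast
  qed
  have G2Q: "?G2 \<subseteq> {z. QQ z = 0}"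
  proof
    fix z assume "z \<in> ?G2"
    then obtain \<mu> k where *: "Re \<mu> = 0" "((?T2 \<mu>) ^^ k) z = 0" by (auto simp: gen_eigenspace_def)
    then have "QQ (((?T2 \<mu>) ^^ k) z) = 0" using linear_0[OF linQQ] by simp
    moreover have "\<mu> \<noteq> 1" using *(1) by auto
    ultimately show "z \<in> {z. QQ z = 0}" using QT2n by blast
  qed
  show ?thesis
  proof (intro equalityI subsetI)
    fix x assume "x \<in> center_subspace L2"
    then have x: "(x, 0) \<in> span ?G2" by (simp add: center_subspace_def)
    have "span ?G2 \<subseteq> {z. QQ z = 0}"
      by (rule span_minimal[OF G2Q]) (rule linear_subspace_kernel[OF linQQ])
    then have "QQ (x, 0) = 0" using x by blast
    then have "x = J (P x)" by (simp add: QQ_def JJ_def PP_def zero_prod_def)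
    moreover have "PP (x, 0) \<in> span ?G1"
      using x span_mono[OF G21] linear_span_image[OF linPP, of ?G2] by blast
    then have "P x \<in> center_subspace L"
      by (simp add: center_subspace_def PP_def linear_0[OF P])
    ultimately show "x \<in> J ` center_subspace L" by (metis imageI)
  next
    fix x assume "x \<in> J ` center_subspace L"
    then obtain y where y: "x = J y" "(y, 0) \<in> span ?G1" by (auto simp: center_subspace_def)
    then have "JJ (y, 0) \<in> span ?G2"
      using span_mono[OF G12] linear_span_image[OF linJJ, of ?G1] by blast
    then show "x \<in> center_subspace L2"
      by (simp add: center_subspace_def JJ_def linear_0[OF J] y(1))
  qed
qed

text \<open>In the inputs of cell \<open>\<sigma>\<close> the argument with index 1 is the state of
  that cell itself, because \<open>1 * \<sigma> = \<sigma>\<close>. Using \<open>v $ 1\<close> in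
  the second term therefore makes the network field the identity on the complement, in every
  cell.\<close>

definition extend_response ::
    "('v1::real_vector \<Rightarrow> 'v2::real_vector) \<Rightarrow> ('v2 \<Rightarrow> 'v1) \<Rightarrow> (('v1, 's::{finite,monoid_mult}) vec \<times> 'p \<Rightarrow> 'v1) \<Rightarrow>
     ('v2, 's) vec \<times> 'p \<Rightarrow> 'v2" where
  "extend_response j q f = (\<lambda>(v, p). j (f (vec_map q v, p)) + (v $ 1 - j (q (v $ 1))))"

lemma net_field_extend_response:
  "net_field (extend_response j q f) v p =
    vec_map j (net_field f (vec_map q v) p) + (v - vec_map j (vec_map q v))"
  by (simp add: vec_eq_iff net_field_def extend_response_def vec_map_def)

lemma smooth_extend_response:
  fixes j :: "'v1::euclidean_space \<Rightarrow> 'v2::euclidean_space"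
    and f :: "('v1, 's::{finite,monoid_mult}) vec \<times> (real^'l) \<Rightarrow> 'v1"
  assumes "linear j" "linear q" "smooth_on_subspace UNIV f"
  shows "smooth_on_subspace UNIV (extend_response j q f)"
  unfolding smooth_on_subspace_def
proof
  fix k
  let ?g = "\<lambda>x :: ('v2, 's) vec \<times> (real^'l). (vec_map q (fst x), snd x)"
  have "linear ?g"
    by (intro linearI) (simp_all add: linear_add[OF linear_vec_map[OF assms(2)]]
        linear_scale[OF linear_vec_map[OF assms(2)]])
  then have "Ck_on k UNIV (\<lambda>x. j (f (?g x)))"
    using assms(1,3) by (intro Ck_on_linear_compose[of k UNIV f ?g UNIV j]) (auto simp: smooth_on_subspace_def)
  moreover have "Ck_on k UNIV (\<lambda>x :: ('v2, 's) vec \<times> (real^'l). fst x $ 1 - j (q (fst x $ 1)))"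
    using assms(1,2) by (intro Ck_on_linear linearI)
      (auto simp: linear_add linear_scale scaleR_diff_right)
  ultimately have "Ck_on k UNIV (\<lambda>x. j (f (?g x)) + (fst x $ 1 - j (q (fst x $ 1))))"
    by (rule Ck_on_add) simp
  moreover have "extend_response j q f = (\<lambda>x. j (f (?g x)) + (fst x $ 1 - j (q (fst x $ 1))))"
    by (auto simp: extend_response_def)
  ultimately show "Ck_on k UNIV (extend_response j q f)" by simp
qed

lemma net_linearization_extend_response:
  fixes j :: "'v1::euclidean_space \<Rightarrow> 'v2::euclidean_space"
    and f :: "('v1, 's::{finite,monoid_mult}) vec \<times> (real^'l) \<Rightarrow> 'v1"
  assumes j: "linear j" and q: "linear q" and f: "smooth_on_subspace UNIV f"
  shows "net_linearization (extend_response j q f) v =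
    vec_map j (net_linearization f (vec_map q v)) + (v - vec_map j (vec_map q v))"
proof -
  let ?J = "vec_map j :: ('v1, 's) vec \<Rightarrow> ('v2, 's) vec"
  let ?P = "vec_map q :: ('v2, 's) vec \<Rightarrow> ('v1, 's) vec"
  have J: "linear ?J" and P: "linear ?P" using linear_vec_map j q by blast+
  have dP: "(?P has_derivative ?P) (at 0)" using P by (rule linear_imp_has_derivative)
  have "((\<lambda>v. net_field f v 0) has_derivative net_linearization f) (at (?P 0))"
    using net_field_has_derivative[OF f] by (simp add: linear_0[OF P])
  from linear_has_derivative_compose[OF J has_derivative_compose[OF dP this]]
  have "((\<lambda>v. ?J (net_field f (?P v) 0) + (v - ?J (?P v))) has_derivative
      (\<lambda>v. ?J (net_linearization f (?P v)) + (v - ?J (?P v)))) (at 0)"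
    by (intro has_derivative_add has_derivative_diff has_derivative_ident linear_has_derivative_compose[OF J dP])
  then show ?thesis
    unfolding net_linearization_def[of "extend_response j q f"] net_field_extend_response
    by (metis (no_types, lifting) frechet_derivative_at)
qed

section \<open>The embedding of internal phase spaces and the conclusion for kernels and
  centers\<close>

lemma linear_left_inverse_exists:
  assumes "DIM('a::euclidean_space) \<le> DIM('b::euclidean_space)"
  obtains j :: "'a::euclidean_space \<Rightarrow> 'b::euclidean_space" and q where "linear j" "linear q" "\<And>x. q (j x) = x"
proof -
  obtain j :: "'a \<Rightarrow> 'b" where j: "linear j" "\<And>x. norm (j x) = norm x"
    using isometry_subset_subspace[of "UNIV :: 'a set" "UNIV :: 'b set"] assms
    by (auto simp: dim_UNIV)
  then have "inj j" by (simp add: linear_injective_0) (metis norm_eq_zero)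
  then obtain q where "linear q" "q \<circ> j = id" using linear_injective_left_inverse[OF j(1)] by blast
  then show ?thesis using that[of j q] j(1) by (auto simp: fun_eq_iff)
qed

lemma net_bifurcation_extend_response:
  fixes j :: "'v1::euclidean_space \<Rightarrow> 'v2::euclidean_space"
    and f :: "('v1, 's::{finite,monoid_mult}) vec \<times> (real^'l) \<Rightarrow> 'v1"
  assumes "linear j" "linear q" "net_bifurcation f"
  shows "net_bifurcation (extend_response j q f)"
proof -
  have "vec_map j (0 :: ('v1, 's) vec) = 0" "vec_map q (0 :: ('v2, 's) vec) = 0"
    using linear_0[OF linear_vec_map] assms(1,2) by blast+
  then show ?thesis
    using assms(3) smooth_extend_response[OF assms(1,2)]
    by (auto simp: net_bifurcation_def net_field_extend_response)
qed

text \<open>\<open>K\<close> is the generalized kernel or the center subspace of the smaller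
  network. The single map \<open>vec_map j\<close> yields both the isomorphism with \<open>U\<close>
  and the conjugation of reduced problems.\<close>

lemma embedded_reduction:
  fixes j :: "'v1::euclidean_space \<Rightarrow> 'v2::euclidean_space"
    and U :: "'u::euclidean_space set" and A :: "'s::{finite,monoid_mult} \<Rightarrow> 'u \<Rightarrow> 'u"
    and K :: "('v1, 's) vec set"
  assumes j: "linear j" and q: "linear q" and qj: "\<And>x. q (j x) = x"
    and U: "is_rep U A" and UK: "rep_iso U A K net_action"
  shows "rep_iso U A (vec_map j ` K) net_action"
    and "equivalent_reduced_problems TYPE(real^'l) Z K net_action (vec_map j ` K) net_action"
proof -
  have iso: "rep_isomorphism K net_action (vec_map j ` K) net_action (vec_map j)"
    by (rule vec_map_rep_isomorphism[OF j q qj])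
  then show "rep_iso U A (vec_map j ` K) net_action"
    using rep_iso_trans[OF UK] rep_iso_def by blast
  have "is_rep K net_action" using UK is_rep_isomorphic U unfolding rep_iso_def by blast
  then show "equivalent_reduced_problems TYPE(real^'l) Z K net_action (vec_map j ` K) net_action"
    by (rule equivalent_reduced_problemsI[OF iso])
qed

text \<open>\<open>U\<close> only records an isomorphism class; the equivalence compares the actual
  subspaces of the two networks. In both halves the witness for \<open>f2\<close> is
  \<open>extend_response j q f1\<close>.\<close>

theorem theorem3p7:
  fixes U :: "'u::euclidean_space set"
    and A :: "'s::{finite,monoid_mult} \<Rightarrow> 'u \<Rightarrow> 'u"
  assumes "CARD('d1::finite) \<le> CARD('d2::finite)"
    and "is_rep U A"
  shows
    "(\<forall>f1 :: (real^'d1, 's) vec \<times> (real^'l) \<Rightarrow> real^'d1. occurs_as_generic_kernel U A f1 \<longrightarrow>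
       (\<exists>f2 :: (real^'d2, 's) vec \<times> (real^'l) \<Rightarrow> real^'d2. occurs_as_generic_kernel U A f2 \<and>
          equivalent_reduced_problems TYPE(real^'l) {0}
            (generalized_kernel (net_linearization f1)) net_action
            (generalized_kernel (net_linearization f2)) net_action)) \<and>
     (\<forall>f1 :: (real^'d1, 's) vec \<times> (real^'l) \<Rightarrow> real^'d1. occurs_as_generic_center U A f1 \<longrightarrow>
       (\<exists>f2 :: (real^'d2, 's) vec \<times> (real^'l) \<Rightarrow> real^'d2. occurs_as_generic_center U A f2 \<and>
          equivalent_reduced_problems TYPE(real^'l) {\<mu>. Re \<mu> = 0}
            (center_subspace (net_linearization f1)) net_action
            (center_subspace (net_linearization f2)) net_action))"
proof -
  have "DIM(real^'d1) \<le> DIM(real^'d2)" using assms(1) by simp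
  then obtain j :: "real^'d1 \<Rightarrow> real^'d2" and q
    where j: "linear j" and q: "linear q" and qj: "\<And>x. q (j x) = x"
    using linear_left_inverse_exists by blast
  let ?J = "vec_map j :: (real^'d1, 's) vec \<Rightarrow> (real^'d2, 's) vec"
  let ?P = "vec_map q :: (real^'d2, 's) vec \<Rightarrow> (real^'d1, 's) vec"
  have J: "linear ?J" and P: "linear ?P" using linear_vec_map j q by blast+
  have PJ: "?P (?J v) = v" for v by (simp add: vec_eq_iff qj)
  have lin: "linear (net_linearization f)"
    if "net_bifurcation f" for f :: "(real^'d1, 's) vec \<times> (real^'l) \<Rightarrow> real^'d1"
    using net_field_has_derivative that has_derivative_linear unfolding net_bifurcation_def by blast
  have kernel: "generalized_kernel (net_linearization (extend_response j q f)) =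
      ?J ` generalized_kernel (net_linearization f)"
    and center: "center_subspace (net_linearization (extend_response j q f)) =
      ?J ` center_subspace (net_linearization f)"
    if f: "net_bifurcation f" for f :: "(real^'d1, 's) vec \<times> (real^'l) \<Rightarrow> real^'d1"
  proof -
    have f': "smooth_on_subspace UNIV f" using f by (simp add: net_bifurcation_def)
    show "generalized_kernel (net_linearization (extend_response j q f)) =
        ?J ` generalized_kernel (net_linearization f)"
      by (rule generalized_kernel_extend[OF J P PJ lin[OF f] net_linearization_extend_response[OF j q f']])
    show "center_subspace (net_linearization (extend_response j q f)) =
        ?J ` center_subspace (net_linearization f)"
      by (rule center_subspace_extend[OF J P PJ lin[OF f] net_linearization_extend_response[OF j q f']])
  qed
  note reduction = embedded_reduction[OF j q qj assms(2)]
  show ?thesis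
  proof (intro conjI allI impI)
    fix f1 :: "(real^'d1, 's) vec \<times> (real^'l) \<Rightarrow> real^'d1"
    assume f1: "occurs_as_generic_kernel U A f1"
    then have bif: "net_bifurcation f1"
      and K: "rep_iso U A (generalized_kernel (net_linearization f1)) net_action"
      and gen: "generic_rep TYPE(real^'d1) kernel_cost CARD('l) U A"
      by (auto simp: occurs_as_generic_kernel_def)
    show "\<exists>f2 :: (real^'d2, 's) vec \<times> (real^'l) \<Rightarrow> real^'d2. occurs_as_generic_kernel U A f2 \<and>
          equivalent_reduced_problems TYPE(real^'l) {0}
            (generalized_kernel (net_linearization f1)) net_action
            (generalized_kernel (net_linearization f2)) net_action"
      using reduction[OF K] generic_rep_embed[OF j q qj assms(2) gen]
        net_bifurcation_extend_response[OF j q bif]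
      by (intro exI[of _ "extend_response j q f1"])
        (simp add: occurs_as_generic_kernel_def kernel[OF bif])
  next
    fix f1 :: "(real^'d1, 's) vec \<times> (real^'l) \<Rightarrow> real^'d1"
    assume f1: "occurs_as_generic_center U A f1"
    then have bif: "net_bifurcation f1"
      and K: "rep_iso U A (center_subspace (net_linearization f1)) net_action"
      and gen: "generic_rep TYPE(real^'d1) center_cost CARD('l) U A"
      by (auto simp: occurs_as_generic_center_def)
    show "\<exists>f2 :: (real^'d2, 's) vec \<times> (real^'l) \<Rightarrow> real^'d2. occurs_as_generic_center U A f2 \<and>
          equivalent_reduced_problems TYPE(real^'l) {\<mu>. Re \<mu> = 0}
            (center_subspace (net_linearization f1)) net_action
            (center_subspace (net_linearization f2)) net_action"
      using reduction[OF K] generic_rep_embed[OF j q qj assms(2) gen]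
        net_bifurcation_extend_response[OF j q bif]
      by (intro exI[of _ "extend_response j q f1"])
        (simp add: occurs_as_generic_center_def center[OF bif])
  qed
qed

end
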